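(* Let $\alpha,\beta,k,\varepsilon,L>0$ and $T_{\rm m}\in\mathbb{R}$ be constants. Let $0<s_0<L$, let $T_0\in C^1([0,s_0];[T_{\rm m},+\infty))$ with $T_0(s_0)=T_{\rm m}$, and let $v_0\ge 0$. Put $$\underline{s}_{\rm r}:=s_0+\varepsilon v_0+\frac{\beta}{\alpha}\int_0^{s_0}(T_0(x)-T_{\rm m})\,dx\ \ (\ge s_0),$$ and let the setpoint $s_{\rm r}$ satisfy $s_{\rm r}>\underline{s}_{\rm r}$. Consider the closed-loop system $$T_t(x,t)=\alpha T_{xx}(x,t)\quad (t>0,\ 0<x<s(t)),$$ $$-kT_x(0,t)=q_{\rm c}(t)\quad (t>0),\qquad T(s(t),t)=T_{\rm m}\quad (t>0),$$ $$\varepsilon\ddot s(t)=-\dot s(t)-\beta T_x(s(t),t)\quad(t>0),$$ $$s(0)=s_0,\qquad \dot s(0)=v_0,\qquad T(x,0)=T_0(x)\ \text{ for } x\in(0,s_0],$$ with the feedback control law $$q_{\rm c}(t)=-\frac{kc_2}{\alpha}\int_0^{s(t)}(T(x,t)-T_{\rm m})\,dx-\frac{k}{\beta}\Big(c_1(s(t)-s_{\rm r})+c_2\varepsilon\,\dot s(t)\Big).$$ Suppose the gains satisfy $$0<c_1\le c_2<\begin{cases}c_1+\overline{c}_2, & \text{if } 12s_{\rm r}^2\le\alpha\varepsilon,\\ c_1+\overline{\overline{c}}_2,&\text{otherwise,}\end{cases}$$ where $$\overline{c}_2:=c_1\frac{s_{\rm r}-\underline{s}_{\rm r}}{\underline{s}_{\rm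 r}-s_0}\quad(\text{read as }+\infty\text{ if }\underline{s}_{\rm r}=s_0),\qquad \overline{\overline{c}}_2:=\min\left\{\overline{c}_2,\ \frac{\alpha\varepsilon c_1+\alpha}{12s_{\rm r}^2-\alpha\varepsilon}\right\}.$$ Then the closed-loop system is exponentially stable in the $H_1$-norm, i.e., there exist positive constants $M>0$, $b>0$ such that $$\Phi(t)\le M\,\Phi(0)\,e^{-bt}\quad\text{for all } t\ge 0,$$ where $\Phi(t):=\|w\|^2+\|w_x\|^2+X^\top X$, with $w$ and $X$ the transformed states of the solution $(T,s)$ defined in the context.
   Context: The unknowns are the temperature $T(x,t)$, defined for $0\le x\le s(t)$, $t\ge0$, and the position $s(t)>0$ of the moving boundary. Solutions are classical: $s\in C^1([0,\infty))\cap C^2((0,\infty))$ with $s(t)>0$; $T$ is continuous on $\{0\le x\le s(t),\,t\ge 0\}$; $T_t$ and $T_{xx}$ exist and are continuous for $0<x<s(t)$, $t>0$; $T_x$ is continuous on $\{0\le x\le s(t),\ t>0\}$; and all the equations hold. Transformed states: put $u(x,t)=T(x,t)-T_{\rm m}$ and $X(t)=\begin{bmatrix}s(t)-s_{\rm r}\\ \dot s(t)\end{bmatrix}\in\mathbb{R}^2$. The (backstepping-transformed) state $w$ is, for $0\le x\le s(t)$, $$w(x,t)=u(x,t)-\frac{c_2}{\alpha}\int_x^{s(t)}(x-y)\,u(y,t)\,dy-\frac{x-s(t)}{\beta}\Big(c_1(s(t)-s_{\rm r})+\varepsilon c_2\,\dot s(t)\Big).$$ Norms are $L^2$ norms over the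 time-varying domain: $\|w\|^2=\int_0^{s(t)}w(x,t)^2\,dx$ and $\|w_x\|^2=\int_0^{s(t)}w_x(x,t)^2\,dx$; at $t=0$ they are computed from the initial data $T_0,s_0,v_0$. *)

theory Defs
  imports "HOL-Analysis.Analysis"
begin

text \<open>
  Derivatives are taken within the relevant set, so at the endpoints of an interval they are the
  one-sided ones, and the values of a function outside its mathematical domain are irrelevant.
\<close>

definition C1_on :: "real set \<Rightarrow> (real \<Rightarrow> real) \<Rightarrow> bool" where
  "C1_on S f \<longleftrightarrow> f differentiable_on S \<and>
     continuous_on S (\<lambda>x. vector_derivative f (at x within S))"

definition sdot :: "(real \<Rightarrow> real) \<Rightarrow> real \<Rightarrow> real" where
  "sdot s t = vector_derivative s (at t within {0..})"

definition sddot :: "(real \<Rightarrow> real) \<Rightarrow> real \<Rightarrow> real" where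
  "sddot s t = vector_derivative (sdot s) (at t)"

definition T_t :: "(real \<Rightarrow> real \<Rightarrow> real) \<Rightarrow> real \<Rightarrow> real \<Rightarrow> real" where
  "T_t T x t = vector_derivative (\<lambda>r. T x r) (at t)"

definition T_x :: "(real \<Rightarrow> real \<Rightarrow> real) \<Rightarrow> (real \<Rightarrow> real) \<Rightarrow> real \<Rightarrow> real \<Rightarrow> real" where
  "T_x T s x t = vector_derivative (\<lambda>y. T y t) (at x within {0..s t})"

definition T_xx :: "(real \<Rightarrow> real \<Rightarrow> real) \<Rightarrow> (real \<Rightarrow> real) \<Rightarrow> real \<Rightarrow> real \<Rightarrow> real" where
  "T_xx T s x t = vector_derivative (\<lambda>y. T_x T s y t) (at x)"

definition classical_regularity :: "(real \<Rightarrow> real \<Rightarrow> real) \<Rightarrow> (real \<Rightarrow> real) \<Rightarrow> bool" where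
  "classical_regularity T s \<longleftrightarrow>
     C1_on {0..} s \<and> C1_on {0<..} (sdot s) \<and> (\<forall>t\<ge>0. s t > 0) \<and>
     continuous_on {(x, t). 0 \<le> t \<and> 0 \<le> x \<and> x \<le> s t} (\<lambda>(x, t). T x t) \<and>
     (\<forall>t>0. \<forall>x\<in>{0<..<s t}. (\<lambda>r. T x r) differentiable (at t)) \<and>
     continuous_on {(x, t). 0 < t \<and> 0 < x \<and> x < s t} (\<lambda>(x, t). T_t T x t) \<and>
     (\<forall>t>0. (\<lambda>y. T y t) differentiable_on {0..s t}) \<and>
     continuous_on {(x, t). 0 < t \<and> 0 \<le> x \<and> x \<le> s t} (\<lambda>(x, t). T_x T s x t) \<and>
     (\<forall>t>0. \<forall>x\<in>{0<..<s t}. (\<lambda>y. T_x T s y t) differentiable (at x)) \<and>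
     continuous_on {(x, t). 0 < t \<and> 0 < x \<and> x < s t} (\<lambda>(x, t). T_xx T s x t)"

definition heat_control ::
  "real \<Rightarrow> real \<Rightarrow> real \<Rightarrow> real \<Rightarrow> real \<Rightarrow> real \<Rightarrow> real \<Rightarrow> real \<Rightarrow>
   (real \<Rightarrow> real \<Rightarrow> real) \<Rightarrow> (real \<Rightarrow> real) \<Rightarrow> real \<Rightarrow> real" where
  "heat_control \<alpha> \<beta> k \<epsilon> Tm sr c1 c2 T s t =
     - (k * c2 / \<alpha>) * integral {0..s t} (\<lambda>x. T x t - Tm)
     - k / \<beta> * (c1 * (s t - sr) + c2 * \<epsilon> * sdot s t)"

definition closed_loop_solution ::
  "real \<Rightarrow> real \<Rightarrow> real \<Rightarrow> real \<Rightarrow> real \<Rightarrow> real \<Rightarrow> real \<Rightarrow> real \<Rightarrow>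
   real \<Rightarrow> real \<Rightarrow> (real \<Rightarrow> real) \<Rightarrow> (real \<Rightarrow> real \<Rightarrow> real) \<Rightarrow> (real \<Rightarrow> real) \<Rightarrow> bool" where
  "closed_loop_solution \<alpha> \<beta> k \<epsilon> Tm sr c1 c2 s0 v0 T0 T s \<longleftrightarrow>
     classical_regularity T s \<and>
     (\<forall>t>0. \<forall>x\<in>{0<..<s t}. T_t T x t = \<alpha> * T_xx T s x t) \<and>
     (\<forall>t>0. - k * T_x T s 0 t = heat_control \<alpha> \<beta> k \<epsilon> Tm sr c1 c2 T s t) \<and>
     (\<forall>t>0. T (s t) t = Tm) \<and>
     (\<forall>t>0. \<epsilon> * sddot s t = - sdot s t - \<beta> * T_x T s (s t) t) \<and>
     s 0 = s0 \<and> sdot s 0 = v0 \<and> (\<forall>x\<in>{0<..s0}. T x 0 = T0 x)"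

definition sr_lower ::
  "real \<Rightarrow> real \<Rightarrow> real \<Rightarrow> real \<Rightarrow> real \<Rightarrow> real \<Rightarrow> (real \<Rightarrow> real) \<Rightarrow> real" where
  "sr_lower \<alpha> \<beta> \<epsilon> Tm s0 v0 T0 =
     s0 + \<epsilon> * v0 + \<beta> / \<alpha> * integral {0..s0} (\<lambda>x. T0 x - Tm)"

definition c2_bar :: "real \<Rightarrow> real \<Rightarrow> real \<Rightarrow> real \<Rightarrow> ereal" where
  "c2_bar c1 sr sl s0 =
     (if sl = s0 then \<infinity> else ereal (c1 * ((sr - sl) / (sl - s0))))"

definition c2_barbar :: "real \<Rightarrow> real \<Rightarrow> real \<Rightarrow> real \<Rightarrow> real \<Rightarrow> real \<Rightarrow> ereal" where
  "c2_barbar \<alpha> \<epsilon> c1 sr sl s0 =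
     min (c2_bar c1 sr sl s0)
         (ereal ((\<alpha> * \<epsilon> * c1 + \<alpha>) / (12 * sr\<^sup>2 - \<alpha> * \<epsilon>)))"

text \<open>
  The transformed states at a fixed time are functions of the temperature profile \<open>\<theta>\<close>, the
  interface position \<open>\<sigma>\<close> and the interface velocity \<open>v\<close> at that time. Along a solution these are
  \<open>T(\<cdot>,t)\<close>, \<open>s t\<close> and \<open>sdot s t\<close>, and initially \<open>T0\<close>, \<open>s0\<close> and \<open>v0\<close>.
\<close>

definition w_state ::
  "real \<Rightarrow> real \<Rightarrow> real \<Rightarrow> real \<Rightarrow> real \<Rightarrow> real \<Rightarrow> real \<Rightarrow>
   (real \<Rightarrow> real) \<Rightarrow> real \<Rightarrow> real \<Rightarrow> real \<Rightarrow> real" where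
  "w_state \<alpha> \<beta> \<epsilon> Tm sr c1 c2 \<theta> \<sigma> v x =
     (\<theta> x - Tm)
     - c2 / \<alpha> * integral {x..\<sigma>} (\<lambda>y. (x - y) * (\<theta> y - Tm))
     - (x - \<sigma>) / \<beta> * (c1 * (\<sigma> - sr) + \<epsilon> * c2 * v)"

definition X_state :: "real \<Rightarrow> real \<Rightarrow> real \<Rightarrow> real ^ 2" where
  "X_state sr \<sigma> v = vector [\<sigma> - sr, v]"

definition L2_sq :: "real \<Rightarrow> (real \<Rightarrow> real) \<Rightarrow> real" where
  "L2_sq \<sigma> f = integral {0..\<sigma>} (\<lambda>x. (f x)\<^sup>2)"

definition Phi ::
  "real \<Rightarrow> real \<Rightarrow> real \<Rightarrow> real \<Rightarrow> real \<Rightarrow> real \<Rightarrow> real \<Rightarrow>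
   (real \<Rightarrow> real) \<Rightarrow> real \<Rightarrow> real \<Rightarrow> real" where
  "Phi \<alpha> \<beta> \<epsilon> Tm sr c1 c2 \<theta> \<sigma> v =
     (let w = w_state \<alpha> \<beta> \<epsilon> Tm sr c1 c2 \<theta> \<sigma> v;
          X = X_state sr \<sigma> v
      in L2_sq \<sigma> w
         + L2_sq \<sigma> (\<lambda>x. vector_derivative w (at x within {0..\<sigma>}))
         + X \<bullet> X)"

end

(*
  The proof avoids energy estimates altogether. Write u = T - Tm and
  Q = c1 (sr - s) - c2 (beta/alpha * int u + eps s'). The control law says u_x(0,t) = -Q/beta, and the
  heat balance gives Q' = -c2 Q + (c2 - c1) s'. The gain bound is Q(0) > 0; a continuation argument with
  the minimum principle then keeps Q > 0, u >= 0 and s' >= 0, hence s < sr. On this cone a linear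
  functional of (int (sr^2 + 1 - x^2) u, s', Q, sr - s) is a Lyapunov function, so all these quantities
  decay exponentially. Comparison with A exp(-b t) g(s(t) - x), where g(z) = 4 sr z - z^2, followed by
  the maximum principle for +-(u(x,t) - u(y,t)) - A exp(-b t) g(x - y) in the variables (x, y, t),
  gives an exponentially decaying Lipschitz constant for u. This bounds Phi pointwise in time;
  since Phi(0) >= (s0 - sr)^2 > 0, the constant M may absorb the dependence on the initial data.
*)
theory Submission
  imports Defs
begin

subsection \<open>Calculus at an extremum\<close>

text \<open>The time derivative of the squared norm of \<open>w_x\<close> involves
  \<open>uxx\<close> up to the boundary, while a classical solution has it continuous only in the
  interior. A maximum principle reads \<open>uxx\<close> at interior points alone, and comparing
  \<open>u\<close> at two points controls its slope without differentiating the heat equation in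
  \<open>x\<close>. The signs depend on each other in a circle: \<open>u \<ge> 0\<close> rests on
  heating at \<open>x = 0\<close>, that is on \<open>Q > 0\<close>; \<open>v \<ge> 0\<close> rests
  on \<open>u \<ge> 0\<close> next to the interface; and \<open>Q > 0\<close> rests on
  \<open>v \<ge> 0\<close>. The circle is opened at the first zero of \<open>Q\<close>. The gain
  bound is the initial sign of \<open>Q\<close> because the lower setpoint exceeds \<open>s0\<close>
  by exactly \<open>\<epsilon> * v0\<close> plus \<open>\<beta> / \<alpha>\<close> times the initial
  heat content. Once all signs are known, a functional that is linear in the unknowns already bounds
  each of them, so heat balances with polynomial weights replace quadratic energies.\<close>

lemma derivative_nonneg_at_left_max:
  fixes f :: "real \<Rightarrow> real"
  assumes "(f has_real_derivative D) (at a)" "b < a"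
    and "\<And>x. b < x \<Longrightarrow> x < a \<Longrightarrow> f x \<le> f a"
  shows "0 \<le> D"
proof (rule ccontr)
  assume "\<not> 0 \<le> D"
  then obtain d where d: "d > 0" "\<And>h. h > 0 \<Longrightarrow> h < d \<Longrightarrow> f a < f (a - h)"
    using has_real_derivative_neg_dec_left[OF assms(1)] by auto
  define h where "h = min d (a - b) / 2"
  have "h > 0" "h < d" "h < a - b" using d(1) assms(2) by (auto simp: h_def min_def field_simps)
  then show False using d(2)[of h] assms(3)[of "a - h"] by auto
qed

text \<open>The range \<open>b\<close> of the comparison may be shorter than the domain
  \<open>c\<close> of the one-sided derivative: with two space variables the left point runs only up
  to the right one.\<close>

lemma derivative_nonpos_at_left_endpoint_max:
  fixes f :: "real \<Rightarrow> real"
  assumes "(f has_real_derivative D) (at a within {a..c})" "a < b" "b \<le> c"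
    and "\<And>x. a < x \<Longrightarrow> x < b \<Longrightarrow> f x \<le> f a"
  shows "D \<le> 0"
proof (rule ccontr)
  assume "\<not> D \<le> 0"
  then obtain d where d: "d > 0" "\<And>h. h > 0 \<Longrightarrow> a + h \<in> {a..c} \<Longrightarrow> h < d \<Longrightarrow> f a < f (a + h)"
    using has_real_derivative_pos_inc_right[OF assms(1)] by auto
  define h where "h = min d (b - a) / 2"
  have "h > 0" "h < d" "h < b - a" using d(1) assms(2) by (auto simp: h_def min_def field_simps)
  then show False using d(2)[of h] assms(3) assms(4)[of "a + h"] by auto
qed

text \<open>At the maximum \<open>f' a = 0\<close>; a positive \<open>D\<close> would make
  \<open>f'\<close> positive just to the right of \<open>a\<close>, and \<open>f\<close> would rise
  above \<open>f a\<close>.\<close>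

lemma second_derivative_nonpos_at_max:
  fixes f :: "real \<Rightarrow> real"
  assumes "l < a" "a < r"
    and f: "\<And>x. l < x \<Longrightarrow> x < r \<Longrightarrow> (f has_real_derivative f' x) (at x)"
    and f': "(f' has_real_derivative D) (at a)"
    and max: "\<And>x. l < x \<Longrightarrow> x < r \<Longrightarrow> f x \<le> f a"
  shows "D \<le> 0"
proof (rule ccontr)
  assume "\<not> D \<le> 0"
  then obtain d where d: "d > 0" "\<And>h. h > 0 \<Longrightarrow> h < d \<Longrightarrow> f' a < f' (a + h)"
    using has_real_derivative_pos_inc_right[OF f'] by auto
  have "f' a = 0"
  proof (rule DERIV_local_max[OF f[OF assms(1,2)], where d = "min (a - l) (r - a)"])
    show "0 < min (a - l) (r - a)" using assms(1,2) by simp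
    show "\<forall>y. \<bar>a - y\<bar> < min (a - l) (r - a) \<longrightarrow> f y \<le> f a"
      by (auto intro!: max)
  qed
  define h where "h = min d (r - a) / 2"
  have h: "h > 0" "h < d" "h < r - a" using d(1) assms(2) by (auto simp: h_def min_def field_simps)
  have "f a < f (a + h)"
  proof (rule DERIV_pos_imp_increasing_open[where a = a and b = "a + h"])
    show "a < a + h" using h by simp
    show "\<exists>y. (f has_real_derivative y) (at x) \<and> 0 < y" if "a < x" "x < a + h" for x
    proof (intro exI conjI)
      show "(f has_real_derivative f' x) (at x)" using that h assms(1) by (intro f) auto
      show "0 < f' x" using d(2)[of "x - a"] that h \<open>f' a = 0\<close> by auto
    qed
    show "continuous_on {a..a + h} f"
      using h assms(1) by (intro continuous_at_imp_continuous_on ballI DERIV_isCont[OF f]) auto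
  qed
  then show False using max[of "a + h"] h assms(1) by auto
qed

text \<open>The left strip costs its length, the right one its squared length because
  \<open>f\<close> vanishes linearly at \<open>\<sigma>\<close>. So a width of order
  \<open>h\<close> may be cut off at the moving end, and of order \<open>h^2\<close> at the fixed
  end, with a total error of order \<open>h^2\<close>.\<close>

lemma abs_integral_le_of_linear_bound:
  fixes f :: "real \<Rightarrow> real"
  assumes "0 \<le> \<delta>" "\<delta> \<le> m" "m \<le> \<sigma>" "continuous_on {0..\<sigma>} f" "B \<ge> 0"
    and "\<And>x. x \<in> {0..\<sigma>} \<Longrightarrow> \<bar>f x\<bar> \<le> B" "\<And>x. x \<in> {0..\<sigma>} \<Longrightarrow> \<bar>f x\<bar> \<le> B * (\<sigma> - x)"
  shows "\<bar>integral {0..\<sigma>} f - integral {\<delta>..m} f\<bar> \<le> B * \<delta> + B * (\<sigma> - m)\<^sup>2"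
proof -
  have int: "f integrable_on {a..b}" if "0 \<le> a" "b \<le> \<sigma>" for a b
    using that assms by (intro integrable_continuous_interval continuous_on_subset[OF assms(4)]) auto
  have "integral {0..\<sigma>} f = integral {0..\<delta>} f + integral {\<delta>..m} f + integral {m..\<sigma>} f"
    using Henstock_Kurzweil_Integration.integral_combine[of 0 \<delta> m f]
      Henstock_Kurzweil_Integration.integral_combine[of 0 m \<sigma> f] int assms by auto
  moreover have "norm (integral {0..\<delta>} f) \<le> B * (\<delta> - 0)"
    using assms by (intro integral_bound continuous_on_subset[OF assms(4)]) auto
  moreover have "norm (integral {m..\<sigma>} f) \<le> (B * (\<sigma> - m)) * (\<sigma> - m)"
  proof (intro integral_bound continuous_on_subset[OF assms(4)])
    fix x assume x: "x \<in> {m..\<sigma>}"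
    have "\<bar>f x\<bar> \<le> B * (\<sigma> - x)" using x assms by auto
    also have "\<dots> \<le> B * (\<sigma> - m)" using x assms by (intro mult_left_mono) auto
    finally show "norm (f x) \<le> B * (\<sigma> - m)" by simp
  qed (use assms in auto)
  ultimately show ?thesis by (auto simp: power2_eq_square algebra_simps)
qed

subsection \<open>The heat balance on a moving domain\<close>

text \<open>No sign of \<open>u\<close>, \<open>v\<close> or the flux is assumed: the heat balance
  holds for arbitrary signs, and positivity is derived later. The heat and interface equations are
  already substituted into the time derivatives.\<close>

locale relaxed_stefan =
  fixes \<alpha> \<beta> \<epsilon> c1 c2 sr :: real
    and u ux uxx :: "real \<Rightarrow> real \<Rightarrow> real"
    and s v :: "real \<Rightarrow> real"
  assumes pos: "\<alpha> > 0" "\<beta> > 0" "\<epsilon> > 0" "c1 > 0" "c1 \<le> c2"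
    and s_deriv: "\<And>t. t \<ge> 0 \<Longrightarrow> (s has_real_derivative v t) (at t within {0..})"
    and s_pos: "\<And>t. t \<ge> 0 \<Longrightarrow> s t > 0"
    and v_cont: "continuous_on {0..} v"
    and v_deriv: "\<And>t. t > 0 \<Longrightarrow>
      (v has_real_derivative (- v t - \<beta> * ux (s t) t) / \<epsilon>) (at t)"
    and u_cont: "continuous_on {(x, t). 0 \<le> t \<and> 0 \<le> x \<and> x \<le> s t} (\<lambda>(x, t). u x t)"
    and u_boundary: "\<And>t. t \<ge> 0 \<Longrightarrow> u (s t) t = 0"
    and heat: "\<And>x t. t > 0 \<Longrightarrow> 0 < x \<Longrightarrow> x < s t \<Longrightarrow>
      ((\<lambda>r. u x r) has_real_derivative \<alpha> * uxx x t) (at t)"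
    and u_x: "\<And>x t. t > 0 \<Longrightarrow> 0 \<le> x \<Longrightarrow> x \<le> s t \<Longrightarrow>
      ((\<lambda>y. u y t) has_real_derivative ux x t) (at x within {0..s t})"
    and ux_cont: "continuous_on {(x, t). 0 < t \<and> 0 \<le> x \<and> x \<le> s t} (\<lambda>(x, t). ux x t)"
    and u_xx: "\<And>x t. t > 0 \<Longrightarrow> 0 < x \<Longrightarrow> x < s t \<Longrightarrow>
      ((\<lambda>y. ux y t) has_real_derivative uxx x t) (at x)"
    and uxx_cont: "continuous_on {(x, t). 0 < t \<and> 0 < x \<and> x < s t} (\<lambda>(x, t). uxx x t)"
    and flux: "\<And>t. t > 0 \<Longrightarrow> ux 0 t =
      c2 / \<alpha> * integral {0..s t} (\<lambda>x. u x t) + (c1 * (s t - sr) + c2 * \<epsilon> * v t) / \<beta>"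
begin

lemma s_cont: "continuous_on {0..} s"
  using s_deriv by (auto simp: continuous_on_eq_continuous_within intro: DERIV_continuous)

lemma s_deriv_at: "t > 0 \<Longrightarrow> (s has_real_derivative v t) (at t)"
  using s_deriv[of t] at_within_interior[of t "{0..}"] by simp

text \<open>The region is the image of a rectangle under the map from \<open>(\<xi>, t)\<close> to
  \<open>(\<xi> * s t, t)\<close>. Compactness supplies the extremal points of the maximum
  principles.\<close>

lemma compact_region:
  assumes "0 \<le> a"
  shows "compact {(x, t). a \<le> t \<and> t \<le> b \<and> 0 \<le> x \<and> x \<le> s t}"
proof -
  have "{(x, t). a \<le> t \<and> t \<le> b \<and> 0 \<le> x \<and> x \<le> s t} =
      (\<lambda>(\<xi>, t). (\<xi> * s t, t)) ` ({0..1} \<times> {a..b})" (is "?L = ?R")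
  proof
    show "?L \<subseteq> ?R"
    proof clarify
      fix x t assume *: "a \<le> t" "t \<le> b" "0 \<le> x" "x \<le> s t"
      then have "s t > 0" using assms s_pos by auto
      with * show "(x, t) \<in> ?R" by (intro image_eqI[of _ _ "(x / s t, t)"]) (auto simp: divide_simps)
    qed
    show "?R \<subseteq> ?L"
    proof clarify
      fix \<xi> t :: real assume *: "\<xi> \<in> {0..1}" "t \<in> {a..b}"
      then have "s t > 0" using assms s_pos by auto
      with * show "a \<le> t \<and> t \<le> b \<and> 0 \<le> \<xi> * s t \<and> \<xi> * s t \<le> s t"
        by (auto simp: mult_left_le_one_le)
    qed
  qed
  moreover have "continuous_on ({0..1} \<times> {a..b}) (\<lambda>(\<xi>, t). (\<xi> * s t, t))"
    unfolding case_prod_unfold using assms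
    by (intro continuous_intros continuous_on_compose2[OF s_cont]) auto
  ultimately show ?thesis
    by (simp add: compact_Times compact_continuous_image del: split_paired_All)
qed

lemma u_cont_x: "t \<ge> 0 \<Longrightarrow> continuous_on {0..s t} (\<lambda>x. u x t)"
  using continuous_on_compose2[OF u_cont, of "{0..s t}" "\<lambda>x. (x, t)"]
  by (simp add: continuous_on_Pair image_subset_iff)

lemma u_x_interior:
  assumes "t > 0" "0 < x" "x < s t"
  shows "((\<lambda>y. u y t) has_real_derivative ux x t) (at x)"
  using u_x[of t x] assms at_within_interior[of x "{0..s t}"] by simp

text \<open>Scaling \<open>x = s t * \<xi>\<close> fixes the domain and leaves a parameter integral
  over the unit interval.\<close>

lemma weighted_integral_cont:
  assumes \<phi>: "continuous_on UNIV \<phi>"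
  shows "continuous_on {0..} (\<lambda>t. integral {0..s t} (\<lambda>x. \<phi> x * u x t))"
proof -
  have "continuous_on ({0..} \<times> cbox 0 1) (\<lambda>(t, \<xi>). \<phi> (s t * \<xi>) * u (s t * \<xi>) t)"
  proof -
    have "continuous_on ({0..} \<times> cbox 0 (1::real)) (\<lambda>z. (\<lambda>(x, t). u x t) (s (fst z) * snd z, fst z))"
      using s_pos
      by (intro continuous_on_compose2[OF u_cont] continuous_intros continuous_on_compose2[OF s_cont])
        (auto simp: mult_left_le less_imp_le)
    moreover have "continuous_on ({0..} \<times> cbox 0 (1::real)) (\<lambda>z. \<phi> (s (fst z) * snd z))"
      by (intro continuous_on_compose2[OF \<phi>] continuous_intros continuous_on_compose2[OF s_cont]) auto
    ultimately show ?thesis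
      unfolding case_prod_unfold by (intro continuous_on_mult) auto
  qed
  from integral_continuous_on_param[OF this]
  have "continuous_on {0..} (\<lambda>t. s t * integral {0..1} (\<lambda>\<xi>. \<phi> (s t * \<xi>) * u (s t * \<xi>) t))"
    by (intro continuous_intros s_cont) simp
  moreover have "s t * integral {0..1} (\<lambda>\<xi>. \<phi> (s t * \<xi>) * u (s t * \<xi>) t) =
      integral {0..s t} (\<lambda>x. \<phi> x * u x t)" if "t \<ge> 0" for t
  proof -
    have "s t > 0" using s_pos that by simp
    then have "(\<lambda>x. x / s t) ` {0..s t} = {0..1}" by simp
    with integral_stretch_real[of "s t" 0 "s t" "\<lambda>x. \<phi> x * u x t"] \<open>s t > 0\<close>
    show ?thesis by (simp add: divide_simps mult.commute)
  qed
  ultimately show ?thesis by (subst continuous_on_cong[OF refl, where g = "\<lambda>t. s t * integral {0..1} (\<lambda>\<xi>. \<phi> (s t * \<xi>) * u (s t * \<xi>) t)"]) auto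
qed

lemma integral_cont: "continuous_on {0..} (\<lambda>t. integral {0..s t} (\<lambda>x. u x t))"
  using weighted_integral_cont[of "\<lambda>_. 1"] by simp

text \<open>On a fixed interval inside the domain one may differentiate under the integral; two
  integrations by parts then move both space derivatives onto the weight, whose second derivative is
  \<open>- 2 * q\<close>.\<close>

lemma rectangle_mass_deriv:
  assumes "0 < \<tau>1" "\<tau> \<in> {\<tau>1..\<tau>2}" "0 < a" "a \<le> b" "\<And>r. r \<in> {\<tau>1..\<tau>2} \<Longrightarrow> b < s r"
  shows "((\<lambda>r. integral {a..b} (\<lambda>x. (p - q * x\<^sup>2) * u x r)) has_real_derivative
    \<alpha> * ((p - q * b\<^sup>2) * ux b \<tau> + 2 * q * b * u b \<tau> - (p - q * a\<^sup>2) * ux a \<tau> - 2 * q * a * u a \<tau>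
      - 2 * q * integral {a..b} (\<lambda>x. u x \<tau>))) (at \<tau> within {\<tau>1..\<tau>2})"
proof -
  have sub: "continuous_on {a..b} (\<lambda>x. u x r)" if "r \<in> {\<tau>1..\<tau>2}" for r
    using assms(1-4) that assms(5)[OF that] by (intro continuous_on_subset[OF u_cont_x]) auto
  have 1: "((\<lambda>r. integral (cbox a b) (\<lambda>x. (p - q * x\<^sup>2) * u x r)) has_real_derivative
      integral (cbox a b) (\<lambda>x. (p - q * x\<^sup>2) * (\<alpha> * uxx x \<tau>))) (at \<tau> within {\<tau>1..\<tau>2})"
  proof (rule leibniz_rule_field_derivative)
    fix r x assume *: "r \<in> {\<tau>1..\<tau>2}" "x \<in> cbox a b"
    have "((\<lambda>r. u x r) has_real_derivative \<alpha> * uxx x r) (at r)"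
      using * assms(1-4) assms(5)[OF *(1)] by (intro heat) auto
    from DERIV_cmult[OF this, of "p - q * x\<^sup>2"]
    show "((\<lambda>r. (p - q * x\<^sup>2) * u x r) has_real_derivative (p - q * x\<^sup>2) * (\<alpha> * uxx x r))
        (at r within {\<tau>1..\<tau>2})"
      by (rule has_field_derivative_at_within)
  next
    fix r assume *: "r \<in> {\<tau>1..\<tau>2}"
    show "(\<lambda>x. (p - q * x\<^sup>2) * u x r) integrable_on cbox a b"
      using sub[OF *] by (intro integrable_continuous continuous_intros) auto
  next
    have "continuous_on ({\<tau>1..\<tau>2} \<times> cbox a b) (\<lambda>z. (\<lambda>(x, t). uxx x t) (snd z, fst z))"
      using assms(1-4) assms(5)
      by (intro continuous_on_compose2[OF uxx_cont] continuous_intros) fastforce+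
    then show "continuous_on ({\<tau>1..\<tau>2} \<times> cbox a b) (\<lambda>(r, x). (p - q * x\<^sup>2) * (\<alpha> * uxx x r))"
      unfolding case_prod_unfold by (intro continuous_intros) auto
  qed (use assms in auto)
  \<comment> \<open>For the weight \<open>\<phi> x = p - q * x^2\<close> this is
    \<open>\<phi> * ux - \<phi>' * u\<close>, an antiderivative of
    \<open>\<phi> * uxx - \<phi>'' * u\<close>.\<close>
  define F where "F x = (p - q * x\<^sup>2) * ux x \<tau> + 2 * q * x * u x \<tau>" for x
  have "((\<lambda>x. (p - q * x\<^sup>2) * uxx x \<tau> + 2 * q * u x \<tau>) has_integral (F b - F a)) {a..b}"
  proof (rule fundamental_theorem_of_calculus)
    fix x assume x: "x \<in> {a..b}"
    then have *: "\<tau> > 0" "0 < x" "x < s \<tau>" using assms(1-4) assms(5)[of \<tau>] by auto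
    show "(F has_vector_derivative (p - q * x\<^sup>2) * uxx x \<tau> + 2 * q * u x \<tau>) (at x within {a..b})"
      unfolding F_def has_real_derivative_iff_has_vector_derivative[symmetric]
      by (rule has_field_derivative_at_within)
        (auto intro!: derivative_eq_intros u_x_interior[OF *] u_xx[OF *] simp: algebra_simps)
  qed (use assms in auto)
  moreover have "((\<lambda>x. 2 * q * u x \<tau>) has_integral 2 * q * integral {a..b} (\<lambda>x. u x \<tau>)) {a..b}"
    using assms by (intro has_integral_mult_right integrable_integral integrable_continuous_interval sub)
  ultimately have "((\<lambda>x. ((p - q * x\<^sup>2) * uxx x \<tau> + 2 * q * u x \<tau>) - 2 * q * u x \<tau>) has_integral
      (F b - F a - 2 * q * integral {a..b} (\<lambda>x. u x \<tau>))) {a..b}"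
    by (rule has_integral_diff)
  then have "((\<lambda>x. (p - q * x\<^sup>2) * uxx x \<tau>) has_integral
      (F b - F a - 2 * q * integral {a..b} (\<lambda>x. u x \<tau>))) {a..b}"
    by simp
  from has_integral_mult_right[OF this, of \<alpha>]
  have "integral (cbox a b) (\<lambda>x. (p - q * x\<^sup>2) * (\<alpha> * uxx x \<tau>)) =
     \<alpha> * (F b - F a - 2 * q * integral {a..b} (\<lambda>x. u x \<tau>))"
    by (intro integral_unique) (simp add: algebra_simps)
  then show ?thesis
    using 1 by (simp add: F_def diff_diff_eq add.assoc)
qed

text \<open>
  No integrability of \<open>uxx\<close> up to the boundary is assumed. The difference quotient at distance \<open>h\<close>
  from \<open>t0\<close> is therefore split into a rectangle \<open>[h\<^sup>2, s t0 - O(h)]\<close> inside the domain, treated by the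
  mean value theorem, and two boundary strips that contribute \<open>O(h\<^sup>2)\<close> because \<open>u\<close> vanishes linearly
  at \<open>x = s t\<close>.
\<close>
lemma weighted_mass_deriv:
  assumes t0: "0 < t0"
  shows "((\<lambda>t. integral {0..s t} (\<lambda>x. (p - q * x\<^sup>2) * u x t)) has_real_derivative
    \<alpha> * ((p - q * (s t0)\<^sup>2) * ux (s t0) t0 - p * ux 0 t0 - 2 * q * integral {0..s t0} (\<lambda>x. u x t0)))
    (at t0)"
proof -
  define I where "I t = integral {0..s t} (\<lambda>x. (p - q * x\<^sup>2) * u x t)" for t
  define J where "J a b t = integral {a..b} (\<lambda>x. (p - q * x\<^sup>2) * u x t)" for a b t
  define D where "D a b t = \<alpha> * ((p - q * b\<^sup>2) * ux b t + 2 * q * b * u b t - (p - q * a\<^sup>2) * ux a t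
    - 2 * q * a * u a t - 2 * q * integral {a..b} (\<lambda>x. u x t))" for a b t
  \<comment> \<open>The window stays away from time 0, where \<open>ux\<close> is not assumed
    continuous.\<close>
  let ?R = "{(x, t). t0 / 2 \<le> t \<and> t \<le> 2 * t0 \<and> 0 \<le> x \<and> x \<le> s t}"
  have R: "compact ?R" using t0 by (intro compact_region) auto
  have cont: "continuous_on ?R (\<lambda>(x, t). u x t)" "continuous_on ?R (\<lambda>(x, t). ux x t)"
    using t0 by (auto intro: continuous_on_subset[OF u_cont] continuous_on_subset[OF ux_cont])
  obtain C1 where C1: "\<And>z. z \<in> ?R \<Longrightarrow> norm (case z of (x, t) \<Rightarrow> u x t) \<le> C1"
    using compact_imp_bounded[OF compact_continuous_image[OF cont(1) R]]
    unfolding bounded_iff ball_simps by blast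
  obtain C2 where C2: "\<And>z. z \<in> ?R \<Longrightarrow> norm (case z of (x, t) \<Rightarrow> ux x t) \<le> C2"
    using compact_imp_bounded[OF compact_continuous_image[OF cont(2) R]]
    unfolding bounded_iff ball_simps by blast
  define C where "C = max C1 C2"
  have C: "\<bar>u x t\<bar> \<le> C" "\<bar>ux x t\<bar> \<le> C" if "(x, t) \<in> ?R" for x t
    using C1[OF that] C2[OF that] unfolding C_def prod.case real_norm_def by linarith+
  have "bounded (s ` {t0 / 2..2 * t0})" "bounded (v ` {t0 / 2..2 * t0})"
    using t0 by (auto intro!: compact_imp_bounded compact_continuous_image
      continuous_on_subset[OF s_cont] continuous_on_subset[OF v_cont])
  then obtain N K where N: "\<And>t. t \<in> {t0 / 2..2 * t0} \<Longrightarrow> \<bar>s t\<bar> \<le> N"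
      and K: "\<And>t. t \<in> {t0 / 2..2 * t0} \<Longrightarrow> \<bar>v t\<bar> \<le> K"
    unfolding bounded_iff ball_simps real_norm_def by blast
  have "t0 \<in> {t0 / 2..2 * t0}" using t0 by auto
  have "(s t0, t0) \<in> ?R" using t0 s_pos[of t0] by auto
  from C[OF this] have "C \<ge> 0" by auto
  have "K \<ge> 0" using K[OF \<open>t0 \<in> _\<close>] by linarith
  \<comment> \<open>The summand 1 lets the same bound serve the weight 1, whose integral appears in
    the derivative as well.\<close>
  define B where "B = C * (\<bar>p\<bar> + \<bar>q\<bar> * N\<^sup>2 + 1)"
  have "B \<ge> 0" using \<open>C \<ge> 0\<close> by (simp add: B_def)
  have u_linear: "\<bar>u x t\<bar> \<le> C * (s t - x)" if t: "t \<in> {t0 / 2..2 * t0}" and x: "x \<in> {0..s t}" for x t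
  proof -
    have "norm (u x t - u (s t) t) \<le> C * norm (x - s t)"
      using t x t0 by (intro field_differentiable_bound[of "{0..s t}" _ "\<lambda>x. ux x t"] u_x)
        (auto intro!: C(2))
    with x u_boundary[of t] t t0 show ?thesis by auto
  qed
  have strip: "\<bar>integral {0..s t} (\<lambda>x. \<psi> x * u x t) - integral {a..b} (\<lambda>x. \<psi> x * u x t)\<bar>
      \<le> B * a + B * (s t - b)\<^sup>2"
    if t: "t \<in> {t0 / 2..2 * t0}" and ab: "0 \<le> a" "a \<le> b" "b \<le> s t"
      and \<psi>: "continuous_on UNIV \<psi>" "\<And>x. \<bar>x\<bar> \<le> N \<Longrightarrow> \<bar>\<psi> x\<bar> \<le> \<bar>p\<bar> + \<bar>q\<bar> * N\<^sup>2 + 1" for t a b \<psi>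
  proof (rule abs_integral_le_of_linear_bound[OF ab])
    show "continuous_on {0..s t} (\<lambda>x. \<psi> x * u x t)"
      using t t0 by (intro continuous_intros u_cont_x continuous_on_subset[OF \<psi>(1)]) auto
    fix x assume x: "x \<in> {0..s t}"
    have \<psi>x: "\<bar>\<psi> x\<bar> \<le> \<bar>p\<bar> + \<bar>q\<bar> * N\<^sup>2 + 1" using \<psi>(2)[of x] N[OF t] x by auto
    have "\<bar>\<psi> x * u x t\<bar> \<le> (\<bar>p\<bar> + \<bar>q\<bar> * N\<^sup>2 + 1) * C"
      unfolding abs_mult using x t \<open>C \<ge> 0\<close> by (intro mult_mono \<psi>x C(1)) auto
    then show "\<bar>\<psi> x * u x t\<bar> \<le> B" by (simp add: B_def mult.commute)
    have "\<bar>\<psi> x * u x t\<bar> \<le> (\<bar>p\<bar> + \<bar>q\<bar> * N\<^sup>2 + 1) * (C * (s t - x))"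
      unfolding abs_mult using x t \<open>C \<ge> 0\<close> by (intro mult_mono \<psi>x u_linear) auto
    then show "\<bar>\<psi> x * u x t\<bar> \<le> B * (s t - x)" by (simp add: B_def mult_ac)
  qed (use \<open>B \<ge> 0\<close> in auto)
  have strip_I: "\<bar>I t - J a b t\<bar> \<le> B * a + B * (s t - b)\<^sup>2"
    if t: "t \<in> {t0 / 2..2 * t0}" and ab: "0 \<le> a" "a \<le> b" "b \<le> s t" for t a b
    unfolding I_def J_def
  proof (rule strip[OF that])
    fix x assume "\<bar>x\<bar> \<le> N"
    then have "\<bar>q * x\<^sup>2\<bar> \<le> \<bar>q\<bar> * N\<^sup>2"
      unfolding abs_mult by (intro mult_left_mono) (auto simp: abs_le_square_iff[symmetric])
    then show "\<bar>p - q * x\<^sup>2\<bar> \<le> \<bar>p\<bar> + \<bar>q\<bar> * N\<^sup>2 + 1" by linarith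
  qed (intro continuous_intros)
  have strip_E: "\<bar>integral {0..s t} (\<lambda>x. u x t) - integral {a..b} (\<lambda>x. u x t)\<bar> \<le> B * a + B * (s t - b)\<^sup>2"
    if t: "t \<in> {t0 / 2..2 * t0}" and ab: "0 \<le> a" "a \<le> b" "b \<le> s t" for t a b
    using strip[OF that, of "\<lambda>_. 1"] by simp
  have s_lip: "\<bar>s t - s t0\<bar> \<le> K * \<bar>t - t0\<bar>" if "t \<in> {t0 / 2..2 * t0}" for t
  proof -
    have "norm (s t - s t0) \<le> K * norm (t - t0)"
      using t0 that by (intro field_differentiable_bound[of "{t0 / 2..2 * t0}" _ v]
        has_field_derivative_at_within[OF s_deriv_at]) (auto intro!: K)
    then show ?thesis by simp
  qed
  define h where "h t = \<bar>t - t0\<bar>" for t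
  \<comment> \<open>Within \<open>h t\<close> of \<open>t0\<close> the interface moves by at most
    \<open>K * h t\<close>, so \<open>b t\<close> stays below it by at least \<open>h t\<close>. At
    \<open>x = 0\<close> the function \<open>u\<close> need not vanish, hence the cut
    \<open>a t\<close> of second order there.\<close>
  define a where "a t = (h t)\<^sup>2" for t
  define b where "b t = s t0 - (K + 1) * h t" for t
  have h_lim: "(h \<longlongrightarrow> 0) (at t0)"
    unfolding h_def by (auto intro!: tendsto_eq_intros)
  have a_lim: "(a \<longlongrightarrow> 0) (at t0)" and b_lim: "(b \<longlongrightarrow> s t0) (at t0)"
    unfolding a_def b_def by (auto intro!: tendsto_eq_intros h_lim)
  have ev1: "\<forall>\<^sub>F t in at t0. a t < b t"
  proof -
    have "((\<lambda>t. b t - a t) \<longlongrightarrow> s t0) (at t0)"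
      by (auto intro!: tendsto_eq_intros a_lim b_lim)
    from order_tendstoD(1)[OF this, of 0] s_pos[of t0] t0 show ?thesis by auto
  qed
  have ev2: "\<forall>\<^sub>F t in at t0. h t < t0 / 2"
    using order_tendstoD(2)[OF h_lim, of "t0 / 2"] t0 by simp
  have ev3: "\<forall>\<^sub>F t in at t0. t \<noteq> t0" by (simp add: eventually_at_filter)
  have near: "r \<in> {t0 / 2..2 * t0} \<and> b t < s r \<and> \<bar>s r - b t\<bar> \<le> (2 * K + 1) * h t"
    if "h t < t0 / 2" "t \<noteq> t0" "\<bar>r - t0\<bar> \<le> h t" for t r
  proof -
    have r: "r \<in> {t0 / 2..2 * t0}" using that t0 by (auto simp: abs_le_iff)
    have "h t > 0" using that by (simp add: h_def)
    have "\<bar>s r - s t0\<bar> \<le> K * h t"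
      using s_lip[OF r] mult_left_mono[OF that(3) \<open>K \<ge> 0\<close>] by linarith
    then show ?thesis using r \<open>h t > 0\<close> \<open>K \<ge> 0\<close> unfolding b_def by (auto simp: algebra_simps abs_le_iff)
  qed
  have "\<forall>\<^sub>F t in at t0. \<exists>\<xi>. \<bar>\<xi> - t0\<bar> \<le> h t \<and> J (a t) (b t) t - J (a t) (b t) t0 = (t - t0) * D (a t) (b t) \<xi>"
    using ev1 ev2 ev3
  proof eventually_elim
    case (elim t)
    \<comment> \<open>\<open>t\<close> may lie on either side of \<open>t0\<close>; the difference
      quotient is symmetric in the two times.\<close>
    define \<tau>1 \<tau>2 where "\<tau>1 = min t t0" and "\<tau>2 = max t t0"
    have rs: "\<bar>r - t0\<bar> \<le> h t" if "r \<in> {\<tau>1..\<tau>2}" for r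
      using that by (auto simp: \<tau>1_def \<tau>2_def h_def min_def max_def split: if_splits)
    have "a t > 0" using elim by (simp add: a_def h_def)
    have "\<tau>1 > 0" using elim t0 by (auto simp: \<tau>1_def h_def abs_if split: if_splits)
    have "\<exists>\<xi>\<in>{\<tau>1<..<\<tau>2}. J (a t) (b t) \<tau>2 - J (a t) (b t) \<tau>1 = D (a t) (b t) \<xi> * (\<tau>2 - \<tau>1)"
    proof (rule mvt_simple[where f' = "\<lambda>\<xi> y. D (a t) (b t) \<xi> * y"])
      show "\<tau>1 < \<tau>2" using elim by (auto simp: \<tau>1_def \<tau>2_def)
      fix r assume r: "\<tau>1 \<le> r" "r \<le> \<tau>2"
      have "(J (a t) (b t) has_real_derivative D (a t) (b t) r) (at r within {\<tau>1..\<tau>2})"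
        unfolding J_def D_def
        using r \<open>a t > 0\<close> \<open>\<tau>1 > 0\<close> elim near rs by (intro rectangle_mass_deriv) auto
      then show "(J (a t) (b t) has_derivative (*) (D (a t) (b t) r)) (at r within {\<tau>1..\<tau>2})"
        by (simp add: has_field_derivative_def)
    qed
    then obtain \<xi> where "\<xi> \<in> {\<tau>1<..<\<tau>2}"
      "J (a t) (b t) \<tau>2 - J (a t) (b t) \<tau>1 = D (a t) (b t) \<xi> * (\<tau>2 - \<tau>1)" by blast
    then show ?case
      using rs[of \<xi>] by (intro exI[of _ \<xi>])
        (auto simp: \<tau>1_def \<tau>2_def min_def max_def algebra_simps split: if_splits)
  qed
  \<comment> \<open>The mean value point becomes a function of \<open>t\<close>, so that its limit
    can be taken.\<close>
  then obtain \<xi> where \<xi>: "\<forall>\<^sub>F t in at t0. \<bar>\<xi> t - t0\<bar> \<le> h t \<and>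
      J (a t) (b t) t - J (a t) (b t) t0 = (t - t0) * D (a t) (b t) (\<xi> t)"
    unfolding eventually_ex by blast
  have \<xi>_lim: "(\<xi> \<longlongrightarrow> t0) (at t0)"
  proof -
    have "((\<lambda>t. \<xi> t - t0) \<longlongrightarrow> 0) (at t0)"
      by (rule Lim_null_comparison[OF _ h_lim]) (use \<xi> in \<open>auto elim: eventually_mono\<close>)
    then show ?thesis by (simp add: LIM_zero_iff)
  qed
  have ev: "\<forall>\<^sub>F t in at t0. 0 < a t \<and> a t < b t \<and> b t < s (\<xi> t) \<and> \<xi> t \<in> {t0 / 2..2 * t0} \<and>
      \<bar>s (\<xi> t) - b t\<bar> \<le> (2 * K + 1) * h t"
    using ev1 ev2 ev3 \<xi> by eventually_elim (use near in \<open>auto simp: a_def h_def\<close>)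
  have in_reg: "\<forall>\<^sub>F t in at t0. (a t, \<xi> t) \<in> {(x, t). 0 < t \<and> 0 \<le> x \<and> x \<le> s t}"
      "\<forall>\<^sub>F t in at t0. (b t, \<xi> t) \<in> {(x, t). 0 < t \<and> 0 \<le> x \<and> x \<le> s t}"
    using ev by (eventually_elim, use t0 in auto)+
  have in_reg': "\<forall>\<^sub>F t in at t0. (a t, \<xi> t) \<in> {(x, t). 0 \<le> t \<and> 0 \<le> x \<and> x \<le> s t}"
      "\<forall>\<^sub>F t in at t0. (b t, \<xi> t) \<in> {(x, t). 0 \<le> t \<and> 0 \<le> x \<and> x \<le> s t}"
    using in_reg by (eventually_elim, auto)+
  have "s t0 > 0" using s_pos t0 by simp
  have ux_lim: "((\<lambda>t. ux (a t) (\<xi> t)) \<longlongrightarrow> ux 0 t0) (at t0)" "((\<lambda>t. ux (b t) (\<xi> t)) \<longlongrightarrow> ux (s t0) t0) (at t0)"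
    using continuous_on_tendsto_compose[OF ux_cont tendsto_Pair[OF a_lim \<xi>_lim] _ in_reg(1)]
      continuous_on_tendsto_compose[OF ux_cont tendsto_Pair[OF b_lim \<xi>_lim] _ in_reg(2)] t0 \<open>s t0 > 0\<close> by auto
  have u_lim: "((\<lambda>t. u (a t) (\<xi> t)) \<longlongrightarrow> u 0 t0) (at t0)" "((\<lambda>t. u (b t) (\<xi> t)) \<longlongrightarrow> 0) (at t0)"
    using continuous_on_tendsto_compose[OF u_cont tendsto_Pair[OF a_lim \<xi>_lim] _ in_reg'(1)]
      continuous_on_tendsto_compose[OF u_cont tendsto_Pair[OF b_lim \<xi>_lim] _ in_reg'(2)] t0 \<open>s t0 > 0\<close>
      u_boundary[of t0] by auto
  have E_lim: "((\<lambda>t. integral {a t..b t} (\<lambda>x. u x (\<xi> t))) \<longlongrightarrow> integral {0..s t0} (\<lambda>x. u x t0)) (at t0)"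
  proof -
    have "((\<lambda>t. integral {0..s (\<xi> t)} (\<lambda>x. u x (\<xi> t))) \<longlongrightarrow> integral {0..s t0} (\<lambda>x. u x t0)) (at t0)"
      using ev t0 by (intro continuous_on_tendsto_compose[OF integral_cont \<xi>_lim])
        (auto elim!: eventually_mono)
    moreover have "((\<lambda>t. integral {0..s (\<xi> t)} (\<lambda>x. u x (\<xi> t)) - integral {a t..b t} (\<lambda>x. u x (\<xi> t))) \<longlongrightarrow> 0) (at t0)"
    proof (rule Lim_null_comparison)
      show "((\<lambda>t. B * a t + B * ((2 * K + 1) * h t)\<^sup>2) \<longlongrightarrow> 0) (at t0)"
        by (auto intro!: tendsto_eq_intros a_lim h_lim)
      show "\<forall>\<^sub>F t in at t0. norm (integral {0..s (\<xi> t)} (\<lambda>x. u x (\<xi> t)) - integral {a t..b t} (\<lambda>x. u x (\<xi> t)))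
          \<le> B * a t + B * ((2 * K + 1) * h t)\<^sup>2"
        using ev
      proof eventually_elim
        case (elim t)
        have "B * (s (\<xi> t) - b t)\<^sup>2 \<le> B * ((2 * K + 1) * h t)\<^sup>2"
          using elim \<open>B \<ge> 0\<close> by (intro mult_left_mono power_mono) auto
        then show ?case using strip_E[of "\<xi> t" "a t" "b t"] elim by auto
      qed
    qed
    ultimately show ?thesis using tendsto_diff by fastforce
  qed
  have D_lim: "((\<lambda>t. D (a t) (b t) (\<xi> t)) \<longlongrightarrow> \<alpha> * ((p - q * (s t0)\<^sup>2) * ux (s t0) t0 - p * ux 0 t0
      - 2 * q * integral {0..s t0} (\<lambda>x. u x t0))) (at t0)"
    unfolding D_def by (auto intro!: tendsto_eq_intros a_lim b_lim ux_lim u_lim E_lim)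
  \<comment> \<open>The error of replacing both full integrals by those over the rectangle: two
    strip terms of order \<open>(h t)^2\<close>, divided by \<open>h t\<close>.\<close>
  define e where "e t = (I t - J (a t) (b t) t - (I t0 - J (a t) (b t) t0)) / (t - t0)" for t
  have "(e \<longlongrightarrow> 0) (at t0)"
  proof (rule Lim_null_comparison)
    show "((\<lambda>t. 2 * (B + B * (2 * K + 1)\<^sup>2) * h t) \<longlongrightarrow> 0) (at t0)"
      by (auto intro!: tendsto_eq_intros h_lim)
    show "\<forall>\<^sub>F t in at t0. norm (e t) \<le> 2 * (B + B * (2 * K + 1)\<^sup>2) * h t"
      using ev1 ev2 ev3
    proof eventually_elim
      case (elim t)
      have "h t > 0" using elim by (simp add: h_def)
      have *: "\<bar>I r - J (a t) (b t) r\<bar> \<le> (B + B * (2 * K + 1)\<^sup>2) * (h t)\<^sup>2" if "\<bar>r - t0\<bar> \<le> h t" for r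
      proof -
        have r: "r \<in> {t0 / 2..2 * t0}" "b t < s r" "\<bar>s r - b t\<bar> \<le> (2 * K + 1) * h t"
          using near[of t r] elim that by auto
        have "\<bar>I r - J (a t) (b t) r\<bar> \<le> B * a t + B * (s r - b t)\<^sup>2"
          using r elim by (intro strip_I) (auto simp: a_def)
        also have "\<dots> \<le> B * a t + B * ((2 * K + 1) * h t)\<^sup>2"
          using r \<open>B \<ge> 0\<close> by (intro add_left_mono mult_left_mono power_mono) auto
        finally show ?thesis
          by (simp only: a_def power_mult_distrib distrib_right[of B] mult.assoc)
      qed
      have "norm (e t) = \<bar>I t - J (a t) (b t) t - (I t0 - J (a t) (b t) t0)\<bar> / h t"
        by (simp add: e_def h_def)
      also have "\<dots> \<le> (2 * (B + B * (2 * K + 1)\<^sup>2) * (h t)\<^sup>2) / h t"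
      proof (rule divide_right_mono)
        have "\<bar>t - t0\<bar> \<le> h t" "\<bar>t0 - t0\<bar> \<le> h t" by (auto simp: h_def)
        from *[OF this(1)] *[OF this(2)]
        show "\<bar>I t - J (a t) (b t) t - (I t0 - J (a t) (b t) t0)\<bar> \<le> 2 * (B + B * (2 * K + 1)\<^sup>2) * (h t)\<^sup>2"
          by linarith
      qed (use \<open>h t > 0\<close> in simp)
      also have "\<dots> = 2 * (B + B * (2 * K + 1)\<^sup>2) * h t"
        using \<open>h t > 0\<close> by (simp add: power2_eq_square)
      finally show ?case .
    qed
  qed
  from tendsto_add[OF D_lim this, unfolded add_0_right]
  have "((\<lambda>t. (I t - I t0) / (t - t0)) \<longlongrightarrow> \<alpha> * ((p - q * (s t0)\<^sup>2) * ux (s t0) t0 - p * ux 0 t0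
      - 2 * q * integral {0..s t0} (\<lambda>x. u x t0))) (at t0)"
  proof (rule Lim_transform_eventually)
    show "\<forall>\<^sub>F t in at t0. D (a t) (b t) (\<xi> t) + e t = (I t - I t0) / (t - t0)"
      using \<xi> ev3
    proof eventually_elim
      case (elim t)
      then have "D (a t) (b t) (\<xi> t) = (J (a t) (b t) t - J (a t) (b t) t0) / (t - t0)" by auto
      then show ?case by (simp add: e_def diff_divide_distrib)
    qed
  qed
  then show ?thesis by (simp add: has_field_derivative_iff I_def)
qed

end

subsection \<open>Positivity of the control\<close>

text \<open>The integrating factor \<open>exp (k * t)\<close> makes \<open>f t * exp (k * t)\<close>
  nondecreasing. Derivatives enter only at interior times, as the equations hold for positive times.
  Applied to the negative of a Lyapunov function it yields an upper bound.\<close>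

lemma exp_lower_bound_of_deriv:
  fixes f :: "real \<Rightarrow> real"
  assumes "0 \<le> T" "continuous_on {0..T} f"
    and "\<And>t. 0 < t \<Longrightarrow> t < T \<Longrightarrow> (f has_real_derivative f' t) (at t)"
    and "\<And>t. 0 < t \<Longrightarrow> t < T \<Longrightarrow> - k * f t \<le> f' t"
  shows "f 0 * exp (- k * T) \<le> f T"
proof -
  have "f 0 * exp (k * 0) \<le> f T * exp (k * T)"
  proof (rule DERIV_nonneg_imp_increasing_open[OF assms(1)])
    fix t assume t: "0 < t" "t < T"
    have "((\<lambda>t. f t * exp (k * t)) has_real_derivative (f' t + k * f t) * exp (k * t)) (at t)"
      by (auto intro!: derivative_eq_intros assms(3) t simp: algebra_simps)
    moreover have "(f' t + k * f t) * exp (k * t) \<ge> 0" using assms(4)[OF t] by simp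
    ultimately show "\<exists>y. ((\<lambda>t. f t * exp (k * t)) has_real_derivative y) (at t) \<and> 0 \<le> y" by blast
  qed (intro continuous_intros assms(2))
  then have "f 0 * exp (- k * T) \<le> f T * exp (k * T) * exp (- k * T)"
    by (intro mult_right_mono) auto
  then show ?thesis by (simp add: mult.assoc exp_minus)
qed

context relaxed_stefan
begin

definition E :: "real \<Rightarrow> real" where
  "E t = integral {0..s t} (\<lambda>x. u x t)"

text \<open>The control input is \<open>Q t\<close> times the conductivity over
  \<open>\<beta>\<close>, so \<open>Q > 0\<close> means that the boundary is heated.\<close>

definition Q :: "real \<Rightarrow> real" where
  "Q t = c1 * (sr - s t) - c2 * (\<beta> / \<alpha> * E t + \<epsilon> * v t)"

lemma E_cont: "continuous_on {0..} E"
  unfolding E_def by (rule integral_cont)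

lemma Q_cont: "continuous_on {0..} Q"
  unfolding Q_def by (intro continuous_intros s_cont v_cont E_cont)

lemma flux_Q: "t > 0 \<Longrightarrow> ux 0 t = - Q t / \<beta>"
  using flux[of t] pos by (simp add: Q_def E_def field_simps)

text \<open>The interface flux \<open>ux (s t) t\<close> enters
  \<open>\<beta> / \<alpha> * E\<close> and \<open>\<epsilon> * v\<close> with opposite signs and
  cancels; what remains is the flux at \<open>x = 0\<close>, which the control law expresses by
  \<open>Q\<close>.\<close>

lemma Q_deriv:
  assumes "t > 0"
  shows "(Q has_real_derivative - c2 * Q t + (c2 - c1) * v t) (at t)"
proof -
  have E: "(E has_real_derivative \<alpha> * (ux (s t) t - ux 0 t)) (at t)"
    using weighted_mass_deriv[OF assms, of 1 0] by (simp add: E_def[abs_def])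
  have "(Q has_real_derivative c1 * (0 - v t)
      - c2 * (\<beta> / \<alpha> * (\<alpha> * (ux (s t) t - ux 0 t)) + \<epsilon> * ((- v t - \<beta> * ux (s t) t) / \<epsilon>))) (at t)"
    unfolding Q_def[abs_def]
    by (intro DERIV_diff DERIV_cmult DERIV_add DERIV_const E s_deriv_at v_deriv assms)
  moreover have "c1 * (0 - v t) - c2 * (\<beta> / \<alpha> * (\<alpha> * (ux (s t) t - ux 0 t)) +
      \<epsilon> * ((- v t - \<beta> * ux (s t) t) / \<epsilon>)) = - c2 * Q t + (c2 - c1) * v t"
    using pos flux_Q[OF assms] by (simp add: field_simps)
  ultimately show ?thesis by simp
qed

text \<open>An extremum over a closed time interval may sit at its final time, so only earlier times
  can be compared; continuity of \<open>s\<close> keeps the fixed point \<open>x\<close> inside the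
  domain at these times.\<close>

lemma inside_before:
  assumes "t > 0" "x < s t"
  obtains b where "0 \<le> b" "b < t" "\<And>r. b < r \<Longrightarrow> r \<le> t \<Longrightarrow> x < s r"
proof -
  have "isCont s t" using s_deriv_at[OF assms(1)] by (rule DERIV_isCont)
  then have "\<forall>\<^sub>F r in at_left t. x < s r"
    using order_tendstoD(1)[of s "s t" "at t" x] assms(2)
    by (auto simp: isCont_def eventually_at_split)
  then obtain b where b: "b < t" "\<And>r. b < r \<Longrightarrow> r < t \<Longrightarrow> x < s r"
    unfolding eventually_at_left_field by blast
  show thesis
    by (rule that[of "max b 0"]) (use b assms in \<open>auto simp: le_less\<close>)
qed

text \<open>A negative minimum cannot sit at \<open>x = 0\<close>, where the slope
  \<open>- Q / \<beta>\<close> is strictly negative, nor at the interface, where \<open>u\<close>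
  vanishes. The tilt \<open>\<eta> * t\<close> makes the interior inequality strict.\<close>

lemma u_nonneg:
  assumes init: "\<And>x. x \<in> {0..s 0} \<Longrightarrow> 0 \<le> u x 0"
    and Q: "\<And>t. 0 < t \<Longrightarrow> t \<le> T \<Longrightarrow> 0 < Q t"
    and tx: "0 \<le> t" "t \<le> T" "0 \<le> x" "x \<le> s t"
  shows "0 \<le> u x t"
proof (rule field_le_epsilon)
  fix e :: real assume "e > 0"
  \<comment> \<open>Dividing by \<open>T + 1\<close> rather than \<open>T\<close> covers
    \<open>T = 0\<close>; the tilt costs at most \<open>e\<close> up to time
    \<open>T\<close>.\<close>
  define \<eta> where "\<eta> = e / (T + 1)"
  have "\<eta> > 0" using \<open>e > 0\<close> tx by (simp add: \<eta>_def)
  let ?S = "{(x, t). 0 \<le> t \<and> t \<le> T \<and> 0 \<le> x \<and> x \<le> s t}"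
  have "continuous_on ?S (\<lambda>(x, t). u x t)"
    by (rule continuous_on_subset[OF u_cont]) auto
  then have cont: "continuous_on ?S (\<lambda>z. (case z of (x, t) \<Rightarrow> u x t) + \<eta> * snd z)"
    by (intro continuous_intros)
  have "(0, 0) \<in> ?S" using tx s_pos[of 0] by auto
  then have "?S \<noteq> {}" by blast
  from continuous_attains_inf[OF compact_region this cont]
  obtain x1 t1 where z1: "(x1, t1) \<in> ?S"
    and min: "\<And>x t. (x, t) \<in> ?S \<Longrightarrow> u x1 t1 + \<eta> * t1 \<le> u x t + \<eta> * t"
    by auto
  have "0 \<le> u x1 t1 + \<eta> * t1"
  proof (rule ccontr)
    assume neg: "\<not> 0 \<le> u x1 t1 + \<eta> * t1"
    have "t1 > 0" using neg init[of x1] z1 by (cases "t1 = 0") auto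
    have "\<eta> * t1 > 0" using \<open>\<eta> > 0\<close> \<open>t1 > 0\<close> by simp
    have "x1 \<noteq> s t1" using neg u_boundary[of t1] \<open>t1 > 0\<close> \<open>\<eta> * t1 > 0\<close> by auto
    then have "x1 < s t1" using z1 by auto
    have max: "- u x t1 \<le> - u x1 t1" if "0 \<le> x" "x \<le> s t1" for x
      using min[of x t1] that z1 by auto
    show False
    proof (cases "x1 = 0")
      case True
      have "- ux 0 t1 \<le> 0"
      proof (rule derivative_nonpos_at_left_endpoint_max)
        show "((\<lambda>y. - u y t1) has_real_derivative - ux 0 t1) (at 0 within {0..s t1})"
          using z1 \<open>t1 > 0\<close> \<open>x1 < s t1\<close> by (intro DERIV_minus u_x) auto
      qed (use True \<open>x1 < s t1\<close> max in auto)
      then show False using flux_Q[OF \<open>t1 > 0\<close>] Q[of t1] z1 pos \<open>t1 > 0\<close> by (auto simp: field_simps)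
    next
      case False
      then have "x1 > 0" using z1 by auto
      have "- uxx x1 t1 \<le> 0"
        using \<open>x1 > 0\<close> \<open>x1 < s t1\<close> \<open>t1 > 0\<close>
        by (intro second_derivative_nonpos_at_max[where f = "\<lambda>x. - u x t1" and f' = "\<lambda>x. - ux x t1"
            and l = 0 and r = "s t1" and a = x1] DERIV_minus u_x_interior u_xx max) auto
      obtain b where b: "0 \<le> b" "b < t1" "\<And>r. b < r \<Longrightarrow> r \<le> t1 \<Longrightarrow> x1 < s r"
        using inside_before[OF \<open>t1 > 0\<close> \<open>x1 < s t1\<close>] by blast
      have "0 \<le> - (\<alpha> * uxx x1 t1) - \<eta>"
      proof (rule derivative_nonneg_at_left_max[OF _ b(2)])
        show "((\<lambda>r. - u x1 r - \<eta> * r) has_real_derivative - (\<alpha> * uxx x1 t1) - \<eta>) (at t1)"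
          using \<open>x1 > 0\<close> \<open>x1 < s t1\<close> \<open>t1 > 0\<close>
          by (auto intro!: derivative_eq_intros heat)
        show "- u x1 r - \<eta> * r \<le> - u x1 t1 - \<eta> * t1" if "b < r" "r < t1" for r
          using min[of x1 r] b(1) b(3)[of r] that z1 \<open>x1 > 0\<close> by auto
      qed
      with \<open>- uxx x1 t1 \<le> 0\<close> \<open>\<eta> > 0\<close> pos show False
        using mult_nonneg_nonneg[of \<alpha> "uxx x1 t1"] by linarith
    qed
  qed
  also have "\<dots> \<le> u x t + \<eta> * t" using min tx by auto
  also have "\<dots> \<le> u x t + e"
    using mult_left_mono[of t "T + 1" \<eta>] tx \<open>\<eta> > 0\<close> by (simp add: \<eta>_def)
  finally show "0 \<le> u x t + e" .
qed

text \<open>Since \<open>u\<close> is nonnegative inside and vanishes at the interface, its slope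
  there is at most 0, which leaves \<open>\<epsilon> * v' \<ge> - v\<close>.\<close>

lemma v_nonneg:
  assumes "0 \<le> v 0" and "0 \<le> T"
    and u: "\<And>t x. 0 < t \<Longrightarrow> t < T \<Longrightarrow> 0 \<le> x \<Longrightarrow> x \<le> s t \<Longrightarrow> 0 \<le> u x t"
  shows "0 \<le> v T"
proof -
  have "v 0 * exp (- (1 / \<epsilon>) * T) \<le> v T"
  proof (rule exp_lower_bound_of_deriv[OF assms(2)])
    fix t assume t: "0 < t" "t < T"
    show "(v has_real_derivative (- v t - \<beta> * ux (s t) t) / \<epsilon>) (at t)" using t by (intro v_deriv)
    have "ux (s t) t \<le> 0"
    proof (rule ccontr)
      assume "\<not> ux (s t) t \<le> 0"
      then obtain d where d: "d > 0"
        "\<And>h. h > 0 \<Longrightarrow> s t - h \<in> {0..s t} \<Longrightarrow> h < d \<Longrightarrow> u (s t - h) t < u (s t) t"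
        using has_real_derivative_pos_inc_left[OF u_x[of t "s t"]] s_pos[of t] t by auto
      define h where "h = min d (s t) / 2"
      have "h > 0" "h < d" "h < s t" using d(1) s_pos[of t] t by (auto simp: h_def)
      then show False using d(2)[of h] u[of t "s t - h"] u_boundary[of t] t by auto
    qed
    then have "\<beta> * ux (s t) t \<le> 0" using pos by (simp add: mult_nonneg_nonpos)
    then show "- (1 / \<epsilon>) * v t \<le> (- v t - \<beta> * ux (s t) t) / \<epsilon>" using pos by (simp add: divide_simps)
  qed (rule continuous_on_subset[OF v_cont], simp)
  moreover have "0 \<le> v 0 * exp (- (1 / \<epsilon>) * T)" using assms(1) by simp
  ultimately show ?thesis by linarith
qed

text \<open>Up to the first zero \<open>T\<close> the velocity is nonnegative, so
  \<open>c1 \<le> c2\<close> gives \<open>Q' \<ge> - c2 * Q\<close>. Then \<open>Q T\<close> is at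
  least \<open>Q 0 * exp (- c2 * T)\<close>, which is positive.\<close>

lemma Q_pos:
  assumes init: "\<And>x. x \<in> {0..s 0} \<Longrightarrow> 0 \<le> u x 0" and v0: "0 \<le> v 0" and Q0: "0 < Q 0" and "0 \<le> t"
  shows "0 < Q t"
proof (rule ccontr)
  assume "\<not> 0 < Q t"
  define Z where "Z = {0..t} \<inter> Q -` {..0}"
  have "closed Z"
    unfolding Z_def
    by (intro continuous_closed_preimage continuous_on_subset[OF Q_cont]) auto
  then have "compact Z"
    unfolding Z_def by (metis compact_Icc compact_Int_closed inf.left_idem)
  have "t \<in> Z" using \<open>\<not> 0 < Q t\<close> \<open>0 \<le> t\<close> by (simp add: Z_def)
  then obtain T where T: "T \<in> Z" "\<And>r. r \<in> Z \<Longrightarrow> T \<le> r"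
    using compact_attains_inf[OF \<open>compact Z\<close>] by blast
  have Qp: "0 < Q r" if "0 \<le> r" "r < T" for r
    using T(1) T(2)[of r] that by (force simp: Z_def)
  have "T \<noteq> 0" "0 \<le> T" using T(1) Q0 by (auto simp: Z_def)
  have u: "0 \<le> u x r" if "0 < r" "r < T" "0 \<le> x" "x \<le> s r" for x r
    using that by (intro u_nonneg[OF init, where T = r]) (auto intro: Qp)
  have v: "0 \<le> v r" if "0 \<le> r" "r \<le> T" for r
    using that by (intro v_nonneg[OF v0] u) auto
  have "Q 0 * exp (- c2 * T) \<le> Q T"
  proof (rule exp_lower_bound_of_deriv[OF \<open>0 \<le> T\<close>])
    fix r assume "0 < r" "r < T"
    then show "(Q has_real_derivative - c2 * Q r + (c2 - c1) * v r) (at r)" by (intro Q_deriv)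
    show "- c2 * Q r \<le> - c2 * Q r + (c2 - c1) * v r"
      using v[of r] pos \<open>0 < r\<close> \<open>r < T\<close> by simp
  qed (rule continuous_on_subset[OF Q_cont], simp)
  moreover have "0 < Q 0 * exp (- c2 * T)" using Q0 by simp
  ultimately show False using T(1) by (auto simp: Z_def)
qed

end

subsection \<open>Exponential decay of the heat content, the velocity and the control\<close>

text \<open>The sum of the coefficients that bound the Lyapunov function by
  \<open>2 * \<beta> * E\<close>, \<open>v\<close> and \<open>Q\<close>:
  \<open>\<kappa> / (2 * \<alpha>)\<close>, then \<open>\<epsilon> * \<kappa>\<close>, then the
  rest. Its reciprocal is the decay rate, which thus depends on parameters only.\<close>

definition lyapunov_const :: "real \<Rightarrow> real \<Rightarrow> real \<Rightarrow> real \<Rightarrow> real \<Rightarrow> real" where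
  "lyapunov_const \<alpha> \<epsilon> c1 c2 sr =
     (let p = sr\<^sup>2 + 1; a = (p + 1) / c2; \<kappa> = p + a * (c2 - c1) * c2 / c1
      in \<kappa> / (2 * \<alpha>) + \<epsilon> * \<kappa> + a + a * (c2 - c1) / c1)"

lemma lyapunov_const_pos:
  assumes "\<alpha> > 0" "\<epsilon> > 0" "c1 > 0" "c1 \<le> c2"
  shows "0 < lyapunov_const \<alpha> \<epsilon> c1 c2 sr"
proof -
  define p a \<kappa> where "p = sr\<^sup>2 + 1" and "a = (p + 1) / c2" and "\<kappa> = p + a * (c2 - c1) * c2 / c1"
  have "p > 0" unfolding p_def by (intro add_nonneg_pos) auto
  then have "a > 0" using assms by (simp add: a_def)
  have "\<kappa> > 0" using \<open>p > 0\<close> \<open>a > 0\<close> assms by (auto simp: \<kappa>_def intro!: add_pos_nonneg)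
  have "0 < \<kappa> / (2 * \<alpha>) + \<epsilon> * \<kappa> + a + a * (c2 - c1) / c1"
    using \<open>a > 0\<close> \<open>\<kappa> > 0\<close> assms by (intro add_pos_nonneg add_pos_pos) auto
  then show ?thesis by (simp only: lyapunov_const_def Let_def p_def a_def \<kappa>_def)
qed

locale stable_stefan = relaxed_stefan +
  assumes u_init: "\<And>x. x \<in> {0..s 0} \<Longrightarrow> 0 \<le> u x 0"
    and v_init: "0 \<le> v 0"
    and Q_init: "0 < Q 0"
begin

lemma Q_gt_0: "0 \<le> t \<Longrightarrow> 0 < Q t"
  by (rule Q_pos[OF u_init v_init Q_init])

lemma u_ge_0: "0 \<le> t \<Longrightarrow> 0 \<le> x \<Longrightarrow> x \<le> s t \<Longrightarrow> 0 \<le> u x t"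
  by (rule u_nonneg[OF u_init, where T = t]) (auto intro: Q_gt_0)

lemma v_ge_0: "0 \<le> t \<Longrightarrow> 0 \<le> v t"
  by (rule v_nonneg[OF v_init _ u_ge_0]) auto

lemma E_ge_0: "0 \<le> t \<Longrightarrow> 0 \<le> E t"
  unfolding E_def
  by (intro integral_nonneg integrable_continuous_interval u_cont_x) (auto intro: u_ge_0)

text \<open>Every term on the right is nonnegative. This gives \<open>s t < sr\<close> and
  eliminates the gap from the upper bound of the Lyapunov function.\<close>

lemma gap_eq: "sr - s t = (Q t + c2 * (\<beta> / \<alpha> * E t + \<epsilon> * v t)) / c1"
  using pos by (simp add: Q_def)

lemma s_less_sr:
  assumes "0 \<le> t"
  shows "s t < sr"
proof -
  have "0 < (Q t + c2 * (\<beta> / \<alpha> * E t + \<epsilon> * v t)) / c1"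
    using Q_gt_0[OF assms] E_ge_0[OF assms] v_ge_0[OF assms] pos
    by (intro divide_pos_pos add_pos_nonneg mult_nonneg_nonneg add_nonneg_nonneg) auto
  then show ?thesis using gap_eq[of t] by linarith
qed

lemma sr_pos: "0 < sr"
  using s_less_sr[of 0] s_pos[of 0] by simp

text \<open>In \<open>V\<close> the factor \<open>p - (s t)^2\<close> of the velocity matches the
  weight at the interface and removes \<open>ux (s t) t\<close>, while the curvature of the weight
  produces \<open>- 2 * \<beta> * E\<close>. Hence \<open>V' \<le> - V / k\<close>, and as all terms
  of \<open>V\<close> are nonnegative, each inherits the decay.\<close>

lemma mass_decay:
  assumes t: "0 \<le> t" and M: "v 0 + Q 0 + 2 * \<beta> * E 0 \<le> M"
  defines "k \<equiv> lyapunov_const \<alpha> \<epsilon> c1 c2 sr"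
  shows "\<epsilon> * v t \<le> k * M * exp (- t / k)" (is ?v)
    and "Q t \<le> c2 * (k * M * exp (- t / k))" (is ?Q)
    and "c1 * (sr - s t) \<le> 3 * c2 * (k * M * exp (- t / k))" (is ?s)
proof -
  \<comment> \<open>Because \<open>s t < sr\<close>, this \<open>p\<close> keeps the weight
    \<open>p - x^2\<close> at least 1 on \<open>[0, s t]\<close>.\<close>
  define p a \<kappa> where "p = sr\<^sup>2 + 1" and "a = (p + 1) / c2" and "\<kappa> = p + a * (c2 - c1) * c2 / c1"
  have "p > 0" unfolding p_def by (intro add_nonneg_pos) auto
  have "p \<ge> 1" by (simp add: p_def)
  have "a > 0" "c2 > 0" using \<open>p > 0\<close> pos by (auto simp: a_def)
  have "\<kappa> > 0" using \<open>p > 0\<close> \<open>a > 0\<close> pos by (auto simp: \<kappa>_def intro!: add_pos_nonneg)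
  have k: "k = \<kappa> / (2 * \<alpha>) + \<epsilon> * \<kappa> + a + a * (c2 - c1) / c1"
    by (simp add: k_def lyapunov_const_def Let_def p_def a_def \<kappa>_def)
  have "k > 0" unfolding k_def using pos by (intro lyapunov_const_pos) auto
  define G where "G t = integral {0..s t} (\<lambda>x. (p - 1 * x\<^sup>2) * u x t)" for t
  have x2: "x\<^sup>2 \<le> sr\<^sup>2" if "0 \<le> r" "0 \<le> x" "x \<le> s r" for x r
    using that s_less_sr[of r] by (intro power_mono) auto
  have G: "E r \<le> G r" "G r \<le> p * E r" if r: "0 \<le> r" for r
  proof -
    have c: "(\<lambda>x. u x r) integrable_on {0..s r}" "(\<lambda>x. (p - 1 * x\<^sup>2) * u x r) integrable_on {0..s r}"
      using r by (auto intro!: integrable_continuous_interval continuous_intros u_cont_x)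
    show "E r \<le> G r"
      unfolding E_def G_def
    proof (rule integral_le[OF c])
      fix x assume x: "x \<in> {0..s r}"
      then have "1 * u x r \<le> (p - 1 * x\<^sup>2) * u x r"
        using r x2[of r x] u_ge_0[of r x] by (intro mult_right_mono) (auto simp: p_def)
      then show "u x r \<le> (p - 1 * x\<^sup>2) * u x r" by simp
    qed
    have "G r \<le> integral {0..s r} (\<lambda>x. p * u x r)"
      unfolding G_def
    proof (rule integral_le[OF c(2)])
      show "(\<lambda>x. p * u x r) integrable_on {0..s r}" by (rule integrable_on_mult_right[OF c(1)])
      show "(p - 1 * x\<^sup>2) * u x r \<le> p * u x r" if "x \<in> {0..s r}" for x
        using r u_ge_0[of r x] that by (intro mult_right_mono) auto
    qed
    then show "G r \<le> p * E r" by (simp add: E_def)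
  qed
  \<comment> \<open>\<open>a\<close> makes the \<open>Q\<close>-decay absorb the inflow \<open>p * Q\<close>, and the last term cancels the \<open>v\<close>-forcing of \<open>Q\<close>.\<close>
  define V where "V t = \<beta> / \<alpha> * G t + \<epsilon> * ((p - (s t)\<^sup>2) * v t) + a * Q t + a * (c2 - c1) * (sr - s t)" for t
  have V_upper: "V r \<le> k * (v r + Q r + 2 * \<beta> * E r)" if r: "0 \<le> r" for r
  proof -
    have nn: "0 \<le> v r" "0 \<le> Q r" "0 \<le> E r"
      using v_ge_0[OF r] Q_gt_0[OF r] E_ge_0[OF r] by auto
    have "\<beta> / \<alpha> * G r \<le> \<beta> / \<alpha> * (p * E r)"
      using G(2)[OF r] pos by (intro mult_left_mono) auto
    moreover have "\<epsilon> * ((p - (s r)\<^sup>2) * v r) \<le> \<epsilon> * (p * v r)"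
      using nn pos by (intro mult_left_mono mult_right_mono) auto
    ultimately have "V r \<le> \<beta> / \<alpha> * (p * E r) + \<epsilon> * (p * v r) + a * Q r
        + a * (c2 - c1) * ((Q r + c2 * (\<beta> / \<alpha> * E r + \<epsilon> * v r)) / c1)"
      unfolding V_def gap_eq by linarith
    also have "\<dots> = \<kappa> / (2 * \<alpha>) * (2 * \<beta> * E r) + \<epsilon> * \<kappa> * v r + (a + a * (c2 - c1) / c1) * Q r"
      using pos by (simp add: \<kappa>_def field_simps)
    also have "\<dots> \<le> k * (2 * \<beta> * E r) + k * v r + k * Q r"
      using nn pos \<open>a > 0\<close> \<open>\<kappa> > 0\<close>
      by (intro add_mono mult_right_mono) (auto simp: k)
    finally show ?thesis by (simp add: algebra_simps)
  qed
  have V_lower: "\<epsilon> * v r \<le> V r" "a * Q r \<le> V r" "\<beta> / \<alpha> * E r \<le> V r" if r: "0 \<le> r" for r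
  proof -
    have "1 * v r \<le> (p - (s r)\<^sup>2) * v r"
      using x2[of r "s r"] v_ge_0[OF r] s_pos[OF r] r by (intro mult_right_mono) (auto simp: p_def)
    then have 1: "\<epsilon> * v r \<le> \<epsilon> * ((p - (s r)\<^sup>2) * v r)" using pos by simp
    have 2: "0 \<le> \<epsilon> * v r" using v_ge_0[OF r] pos by simp
    have 3: "\<beta> / \<alpha> * E r \<le> \<beta> / \<alpha> * G r" using G(1)[OF r] pos by (intro mult_left_mono) auto
    have 4: "0 \<le> \<beta> / \<alpha> * E r" using E_ge_0[OF r] pos by simp
    have 5: "0 \<le> a * Q r" using Q_gt_0[OF r] \<open>a > 0\<close> by simp
    have 6: "0 \<le> a * (c2 - c1) * (sr - s r)" using \<open>a > 0\<close> pos s_less_sr[OF r] by simp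
    from 1 2 3 4 5 6 show "\<epsilon> * v r \<le> V r" "a * Q r \<le> V r" "\<beta> / \<alpha> * E r \<le> V r"
      unfolding V_def by linarith+
  qed
  have "(- V 0) * exp (- (1 / k) * t) \<le> - V t"
  proof (rule exp_lower_bound_of_deriv[OF t])
    have "continuous_on {0..} V"
      unfolding V_def G_def
      by (intro continuous_intros weighted_integral_cont s_cont v_cont Q_cont)
    then show "continuous_on {0..t} (\<lambda>t. - V t)"
      by (intro continuous_intros) (rule continuous_on_subset, auto)
    fix r assume "0 < r" "r < t"
    then have r: "0 \<le> r" by simp
    let ?V' = "\<beta> / \<alpha> * (\<alpha> * ((p - 1 * (s r)\<^sup>2) * ux (s r) r - p * ux 0 r - 2 * 1 * E r))
      + \<epsilon> * ((0 - 2 * s r * v r) * v r + (- v r - \<beta> * ux (s r) r) / \<epsilon> * (p - (s r)\<^sup>2))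
      + a * (- c2 * Q r + (c2 - c1) * v r) + a * (c2 - c1) * (0 - v r)"
    have "((\<lambda>t. (s t)\<^sup>2) has_real_derivative 2 * s r * v r) (at r)"
      by (auto intro!: derivative_eq_intros s_deriv_at \<open>0 < r\<close>)
    moreover have "(G has_real_derivative
        \<alpha> * ((p - 1 * (s r)\<^sup>2) * ux (s r) r - p * ux 0 r - 2 * 1 * E r)) (at r)"
      using weighted_mass_deriv[OF \<open>0 < r\<close>, of p 1] by (simp only: G_def[abs_def] E_def)
    ultimately have "(V has_real_derivative ?V') (at r)"
      unfolding V_def[abs_def]
      by (intro DERIV_add DERIV_cmult DERIV_mult DERIV_diff DERIV_const s_deriv_at v_deriv Q_deriv \<open>0 < r\<close>)
    then show "((\<lambda>t. - V t) has_real_derivative - ?V') (at r)" by (rule DERIV_minus)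
    \<comment> \<open>The last term comes from differentiating \<open>(s r)^2\<close> along the
      moving interface; it has the favourable sign.\<close>
    have "?V' = - (p - (s r)\<^sup>2) * v r - Q r - 2 * \<beta> * E r - 2 * \<epsilon> * s r * (v r)\<^sup>2"
      using pos \<open>c2 > 0\<close> unfolding a_def flux_Q[OF \<open>0 < r\<close>]
      by (simp add: field_simps power2_eq_square)
    moreover have "1 * v r \<le> (p - (s r)\<^sup>2) * v r"
      using x2[of r "s r"] v_ge_0[OF r] s_pos[OF r] r by (intro mult_right_mono) (auto simp: p_def)
    moreover have "0 \<le> 2 * \<epsilon> * s r * (v r)\<^sup>2" using pos s_pos[OF r] by simp
    ultimately have "?V' \<le> - (v r + Q r + 2 * \<beta> * E r)" by linarith
    moreover have "V r / k \<le> v r + Q r + 2 * \<beta> * E r"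
      using V_upper[OF r] \<open>k > 0\<close> by (simp add: divide_simps mult.commute)
    ultimately show "- (1 / k) * - V r \<le> - ?V'" by simp
  qed
  then have "V t \<le> V 0 * exp (- t / k)" by simp
  also have "\<dots> \<le> k * M * exp (- t / k)"
  proof (rule mult_right_mono)
    have "k * (v 0 + Q 0 + 2 * \<beta> * E 0) \<le> k * M" using M \<open>k > 0\<close> by (intro mult_left_mono) auto
    then show "V 0 \<le> k * M" using V_upper[of 0] by linarith
  qed simp
  finally have V: "V t \<le> k * M * exp (- t / k)" .
  have "1 / c2 \<le> a" using \<open>p \<ge> 1\<close> \<open>c2 > 0\<close> by (simp add: a_def divide_right_mono)
  then have "1 / c2 * Q t \<le> a * Q t" using Q_gt_0[OF t] by (intro mult_right_mono) auto
  then have "1 / c2 * Q t \<le> k * M * exp (- t / k)" using V V_lower(2)[OF t] by linarith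
  then show ?Q using \<open>c2 > 0\<close> by (simp add: divide_simps mult_ac)
  show ?v using V V_lower(1)[OF t] by linarith
  \<comment> \<open>One bound each for the heat content and the velocity; with that for
    \<open>Q\<close> they make the factor 3.\<close>
  have "c2 * (\<beta> / \<alpha> * E t + \<epsilon> * v t) \<le> c2 * (2 * (k * M * exp (- t / k)))"
    using V V_lower[OF t] \<open>c2 > 0\<close> by (intro mult_left_mono) auto
  moreover have "c1 * (sr - s t) = Q t + c2 * (\<beta> / \<alpha> * E t + \<epsilon> * v t)"
    by (simp add: Q_def)
  ultimately show ?s using \<open>?Q\<close> by linarith
qed

subsection \<open>Maximum principles with an exponentially decaying comparison function\<close>

text \<open>On \<open>[0, sr]\<close> the slope \<open>4 * sr - 2 * z\<close> is at least
  \<open>2 * sr\<close>, which beats the boundary flux, and \<open>g'' = - 2\<close> keeps a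
  multiple decaying at rate \<open>b\<close> a strict supersolution as long as
  \<open>4 * sr^2 * b \<le> \<alpha>\<close>.\<close>

definition g :: "real \<Rightarrow> real" where
  "g z = 4 * sr * z - z\<^sup>2"

lemma g_lower: "0 \<le> z \<Longrightarrow> z \<le> sr \<Longrightarrow> 3 * sr * z \<le> g z"
  using mult_right_mono[of z sr z] by (simp add: g_def power2_eq_square)

lemma g_upper:
  assumes "0 \<le> z" "z \<le> sr"
  shows "g z \<le> 4 * sr\<^sup>2"
proof -
  have "g z \<le> 4 * sr * z" by (simp add: g_def)
  also have "\<dots> \<le> 4 * sr * sr" using assms sr_pos by (intro mult_left_mono) auto
  finally show ?thesis by (simp add: power2_eq_square)
qed

text \<open>Each part of the boundary has its reason: \<open>\<Lambda> \<le> 3 * sr * A\<close>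
  covers the initial profile, the bound on \<open>Q\<close> covers the slope at
  \<open>x = 0\<close>, and at the interface both sides vanish. Inside, curvature gains
  \<open>2 * a * \<alpha>\<close> against a decay loss of at most
  \<open>a * \<alpha>\<close>.\<close>

lemma barrier:
  assumes b: "0 < b" "4 * sr\<^sup>2 * b \<le> \<alpha>" and A: "0 < A" "\<Lambda> \<le> 3 * sr * A"
    and lip: "\<And>x. x \<in> {0..s 0} \<Longrightarrow> u x 0 \<le> \<Lambda> * (s 0 - x)"
    and Q: "\<And>t. t \<ge> 0 \<Longrightarrow> Q t < 2 * sr * \<beta> * A * exp (- b * t)"
    and tx: "0 \<le> t" "0 \<le> x" "x \<le> s t"
  shows "u x t \<le> A * exp (- b * t) * (4 * sr * (s t - x) - (s t - x)\<^sup>2)"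
proof -
  let ?S = "{(x, r). 0 \<le> r \<and> r \<le> t \<and> 0 \<le> x \<and> x \<le> s r}"
  have "continuous_on ?S (\<lambda>(x, t). u x t)"
    by (rule continuous_on_subset[OF u_cont]) auto
  moreover have "continuous_on ?S (\<lambda>z. s (snd z))"
    by (intro continuous_on_compose2[OF s_cont] continuous_intros) auto
  ultimately have cont: "continuous_on ?S (\<lambda>z. (case z of (x, t) \<Rightarrow> u x t)
      - A * exp (- b * snd z) * g (s (snd z) - fst z))"
    unfolding g_def by (intro continuous_intros)
  have "(x, t) \<in> ?S" using tx by auto
  then have "?S \<noteq> {}" by blast
  from continuous_attains_sup[OF compact_region this cont]
  obtain x1 t1 where z1: "(x1, t1) \<in> ?S"
    and max: "\<And>x t. (x, t) \<in> ?S \<Longrightarrow>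
      u x t - A * exp (- b * t) * g (s t - x) \<le> u x1 t1 - A * exp (- b * t1) * g (s t1 - x1)"
    by auto
  define a where "a = A * exp (- b * t1)"
  have "a > 0" using A by (simp add: a_def)
  have st1: "s t1 < sr" using z1 by (intro s_less_sr) auto
  have "u x1 t1 - a * g (s t1 - x1) \<le> 0"
  proof (rule ccontr)
    assume gt: "\<not> u x1 t1 - a * g (s t1 - x1) \<le> 0"
    have "t1 \<noteq> 0"
    proof
      assume "t1 = 0"
      have "u x1 0 \<le> \<Lambda> * (s 0 - x1)" using z1 \<open>t1 = 0\<close> by (intro lip) auto
      also have "\<dots> \<le> (3 * sr * A) * (s 0 - x1)" using z1 \<open>t1 = 0\<close> A by (intro mult_right_mono) auto
      also have "\<dots> = A * (3 * sr * (s 0 - x1))" by simp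
      also have "\<dots> \<le> A * g (s 0 - x1)"
        using z1 \<open>t1 = 0\<close> A st1 by (intro mult_left_mono g_lower) auto
      finally show False using gt \<open>t1 = 0\<close> by (simp add: a_def)
    qed
    then have "t1 > 0" using z1 by auto
    have "x1 \<noteq> s t1" using gt u_boundary[of t1] \<open>t1 > 0\<close> by (auto simp: g_def)
    then have "x1 < s t1" using z1 by auto
    have max_x: "u x t1 - a * g (s t1 - x) \<le> u x1 t1 - a * g (s t1 - x1)"
      if "0 \<le> x" "x \<le> s t1" for x
      using max[of x t1] that z1 by (auto simp: a_def)
    show False
    proof (cases "x1 = 0")
      case True
      have "ux 0 t1 + a * (4 * sr - 2 * s t1) \<le> 0"
      proof (rule derivative_nonpos_at_left_endpoint_max)
        show "((\<lambda>y. u y t1 - a * g (s t1 - y)) has_real_derivative ux 0 t1 + a * (4 * sr - 2 * s t1))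
            (at 0 within {0..s t1})"
          unfolding g_def using z1 \<open>t1 > 0\<close> \<open>x1 < s t1\<close>
          by (auto intro!: derivative_eq_intros u_x simp: algebra_simps)
      qed (use True \<open>x1 < s t1\<close> max_x in auto)
      moreover have "a * (2 * sr) \<le> a * (4 * sr - 2 * s t1)"
        using \<open>a > 0\<close> st1 by (intro mult_left_mono) auto
      moreover have "\<beta> * ux 0 t1 = - Q t1" using flux_Q[OF \<open>t1 > 0\<close>] pos by simp
      ultimately have "\<beta> * (a * (2 * sr)) \<le> Q t1"
        using pos mult_left_mono[of "a * (2 * sr)" "- ux 0 t1" \<beta>] by auto
      then show False using Q[of t1] \<open>t1 > 0\<close> by (simp add: a_def mult_ac)
    next
      case False
      then have "x1 > 0" using z1 by auto
      have "uxx x1 t1 + 2 * a \<le> 0"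
      proof (rule second_derivative_nonpos_at_max[OF \<open>x1 > 0\<close> \<open>x1 < s t1\<close>])
        show "((\<lambda>x. u x t1 - a * g (s t1 - x)) has_real_derivative
            ux x t1 + a * (4 * sr - 2 * (s t1 - x))) (at x)" if "0 < x" "x < s t1" for x
          unfolding g_def using that \<open>t1 > 0\<close>
          by (auto intro!: derivative_eq_intros u_x_interior simp: algebra_simps)
        show "((\<lambda>x. ux x t1 + a * (4 * sr - 2 * (s t1 - x))) has_real_derivative uxx x1 t1 + 2 * a) (at x1)"
          using \<open>x1 > 0\<close> \<open>x1 < s t1\<close> \<open>t1 > 0\<close> by (auto intro!: derivative_eq_intros u_xx)
      qed (use max_x in auto)
      then have "\<alpha> * (uxx x1 t1 + 2 * a) \<le> 0" using pos by (simp add: mult_nonneg_nonpos)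
      obtain r0 where r0: "0 \<le> r0" "r0 < t1" "\<And>r. r0 < r \<Longrightarrow> r \<le> t1 \<Longrightarrow> x1 < s r"
        using inside_before[OF \<open>t1 > 0\<close> \<open>x1 < s t1\<close>] by blast
      let ?z = "s t1 - x1"
      have z: "0 \<le> ?z" "?z \<le> sr" using \<open>x1 > 0\<close> \<open>x1 < s t1\<close> st1 by auto
      have "0 \<le> \<alpha> * uxx x1 t1 + b * a * g ?z - a * ((4 * sr - 2 * ?z) * v t1)"
      proof (rule derivative_nonneg_at_left_max[OF _ r0(2)])
        show "((\<lambda>r. u x1 r - A * exp (- b * r) * g (s r - x1)) has_real_derivative
            \<alpha> * uxx x1 t1 + b * a * g ?z - a * ((4 * sr - 2 * ?z) * v t1)) (at t1)"
          unfolding g_def a_def using \<open>x1 > 0\<close> \<open>x1 < s t1\<close> \<open>t1 > 0\<close>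
          by (auto intro!: derivative_eq_intros heat s_deriv_at simp: algebra_simps)
        show "u x1 r - A * exp (- b * r) * g (s r - x1) \<le> u x1 t1 - A * exp (- b * t1) * g (s t1 - x1)"
          if "r0 < r" "r < t1" for r
          using max[of x1 r] r0(1) r0(3)[of r] that z1 \<open>x1 > 0\<close> by auto
      qed
      \<comment> \<open>Here \<open>v \<ge> 0\<close> matters: an advancing interface only raises
        the comparison function.\<close>
      moreover have "0 \<le> a * ((4 * sr - 2 * ?z) * v t1)"
        using \<open>a > 0\<close> z sr_pos v_ge_0[of t1] \<open>t1 > 0\<close> by simp
      moreover have "b * a * g ?z \<le> b * a * (4 * sr\<^sup>2)"
        using b \<open>a > 0\<close> by (intro mult_left_mono g_upper z) auto
      moreover have "a * (4 * sr\<^sup>2 * b) \<le> a * \<alpha>"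
        using b \<open>a > 0\<close> by (intro mult_left_mono) auto
      moreover have "0 < a * \<alpha>" using \<open>a > 0\<close> pos by simp
      ultimately show False using \<open>\<alpha> * (uxx x1 t1 + 2 * a) \<le> 0\<close> by (simp add: algebra_simps)
    qed
  qed
  then show ?thesis using max[OF \<open>(x, t) \<in> ?S\<close>] by (simp add: a_def g_def)
qed

section \<open>Comparison of two points at the same time (doubling of variables)\<close>

lemma compact_pair_region:
  "compact {(x, y, t). 0 \<le> t \<and> t \<le> T \<and> 0 \<le> y \<and> y \<le> x \<and> x \<le> s t}"
proof -
  let ?S = "{(x, t). 0 \<le> t \<and> t \<le> T \<and> 0 \<le> x \<and> x \<le> s t}"
  let ?f = "\<lambda>z :: (real \<times> real) \<times> real. (fst (fst z), snd z * fst (fst z), snd (fst z))"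
  have "{(x, y, t). 0 \<le> t \<and> t \<le> T \<and> 0 \<le> y \<and> y \<le> x \<and> x \<le> s t} = ?f ` (?S \<times> {0..1})" (is "?L = ?R")
  proof
    show "?L \<subseteq> ?R"
    proof clarify
      fix x y t assume "0 \<le> t" "t \<le> T" "0 \<le> y" "y \<le> x" "x \<le> s t"
      then show "(x, y, t) \<in> ?R"
        by (intro image_eqI[of _ _ "((x, t), y / x)"]) (auto simp: divide_simps)
    qed
    show "?R \<subseteq> ?L" by (auto simp: mult_left_le_one_le)
  qed
  moreover have "compact (?f ` (?S \<times> {0..1}))"
    by (intro compact_continuous_image compact_Times compact_region continuous_intros) auto
  ultimately show ?thesis by simp
qed

text \<open>The faces of the region are excluded by the initial Lipschitz bound at
  \<open>t = 0\<close>, by equality on \<open>x = y\<close>, by the barrier and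
  \<open>u \<ge> 0\<close> at \<open>x = s t\<close>, and by the flux at \<open>y = 0\<close>.
  Inside, \<open>x\<close> and \<open>y\<close> vary independently, so each gets its own second
  derivative test. \<open>\<sigma>\<close> lets one argument serve both signs of the
  difference.\<close>

lemma modulus_of_continuity:
  assumes b: "0 < b" "4 * sr\<^sup>2 * b \<le> \<alpha>" and A: "0 < A" "\<Lambda> \<le> 3 * sr * A"
    and lip: "\<And>x y. x \<in> {0..s 0} \<Longrightarrow> y \<in> {0..s 0} \<Longrightarrow> \<bar>u x 0 - u y 0\<bar> \<le> \<Lambda> * \<bar>x - y\<bar>"
    and Q: "\<And>t. t \<ge> 0 \<Longrightarrow> Q t < 2 * sr * \<beta> * A * exp (- b * t)"
    and \<sigma>: "\<sigma> \<in> {-1, 1}"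
    and txy: "0 \<le> t" "0 \<le> y" "y \<le> x" "x \<le> s t"
  shows "\<sigma> * (u x t - u y t) \<le> A * exp (- b * t) * (4 * sr * (x - y) - (x - y)\<^sup>2)"
proof -
  let ?S = "{(x, y, r). 0 \<le> r \<and> r \<le> t \<and> 0 \<le> y \<and> y \<le> x \<and> x \<le> s r}"
  have "continuous_on ?S (\<lambda>z. (\<lambda>(x, t). u x t) (fst z, snd (snd z)))"
    by (intro continuous_on_compose2[OF u_cont] continuous_intros) auto
  moreover have "continuous_on ?S (\<lambda>z. (\<lambda>(x, t). u x t) (fst (snd z), snd (snd z)))"
    by (intro continuous_on_compose2[OF u_cont] continuous_intros) auto
  ultimately have cont: "continuous_on ?S (\<lambda>z. \<sigma> * (u (fst z) (snd (snd z)) - u (fst (snd z)) (snd (snd z)))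
      - A * exp (- b * snd (snd z)) * g (fst z - fst (snd z)))"
    unfolding g_def prod.case by (intro continuous_intros)
  have "(x, y, t) \<in> ?S" using txy by auto
  then have "?S \<noteq> {}" by blast
  from continuous_attains_sup[OF compact_pair_region this cont]
  obtain x1 y1 t1 where z1: "(x1, y1, t1) \<in> ?S"
    and max: "\<And>x y t. (x, y, t) \<in> ?S \<Longrightarrow>
      \<sigma> * (u x t - u y t) - A * exp (- b * t) * g (x - y) \<le>
      \<sigma> * (u x1 t1 - u y1 t1) - A * exp (- b * t1) * g (x1 - y1)"
    by auto
  define a where "a = A * exp (- b * t1)"
  have "a > 0" using A by (simp add: a_def)
  have t1: "0 \<le> t1" and xy1: "0 \<le> y1" "y1 \<le> x1" "x1 \<le> s t1" using z1 by auto
  have st1: "s t1 < sr" using z1 by (intro s_less_sr) auto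
  have "\<sigma> * (u x1 t1 - u y1 t1) - a * g (x1 - y1) \<le> 0"
  proof (rule ccontr)
    assume gt: "\<not> \<sigma> * (u x1 t1 - u y1 t1) - a * g (x1 - y1) \<le> 0"
    have "t1 \<noteq> 0"
    proof
      assume "t1 = 0"
      have "\<sigma> * (u x1 0 - u y1 0) \<le> \<bar>u x1 0 - u y1 0\<bar>" using \<sigma> by auto
      also have "\<dots> \<le> \<Lambda> * \<bar>x1 - y1\<bar>" using xy1 \<open>t1 = 0\<close> by (intro lip) auto
      also have "\<dots> \<le> (3 * sr * A) * \<bar>x1 - y1\<bar>" using A by (intro mult_right_mono) auto
      also have "\<dots> = A * (3 * sr * (x1 - y1))" using xy1 by simp
      also have "\<dots> \<le> A * g (x1 - y1)"
        using xy1 A st1 by (intro mult_left_mono g_lower) auto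
      finally show False using gt \<open>t1 = 0\<close> by (simp add: a_def)
    qed
    then have "t1 > 0" using t1 by auto
    have "y1 < x1" using gt xy1 by (cases "y1 = x1") (auto simp: g_def)
    have "x1 \<noteq> s t1"
    proof
      assume x1: "x1 = s t1"
      \<comment> \<open>The difference is \<open>- u y1 t1\<close> for \<open>\<sigma> = 1\<close>,
        handled by \<open>u \<ge> 0\<close>, and \<open>u y1 t1\<close> for
        \<open>\<sigma> = -1\<close>, handled by the barrier.\<close>
      have "u y1 t1 \<le> a * g (s t1 - y1)"
        unfolding a_def g_def
      proof (rule barrier[OF b A _ Q])
        show "u x 0 \<le> \<Lambda> * (s 0 - x)" if "x \<in> {0..s 0}" for x
          using lip[of x "s 0"] that s_pos[of 0] u_boundary[of 0] by auto
      qed (use xy1 t1 in auto)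
      moreover have "0 \<le> u y1 t1" using xy1 t1 by (intro u_ge_0) auto
      moreover have "0 \<le> a * g (s t1 - y1)" using calculation by linarith
      ultimately show False using gt x1 u_boundary[OF t1] \<sigma> by auto
    qed
    then have "x1 < s t1" using xy1 by auto
    have max_x: "\<sigma> * (u x t1 - u y1 t1) - a * g (x - y1) \<le> \<sigma> * (u x1 t1 - u y1 t1) - a * g (x1 - y1)"
      if "y1 \<le> x" "x \<le> s t1" for x
      using max[of x y1 t1] that z1 by (auto simp: a_def)
    have max_y: "\<sigma> * (u x1 t1 - u y t1) - a * g (x1 - y) \<le> \<sigma> * (u x1 t1 - u y1 t1) - a * g (x1 - y1)"
      if "0 \<le> y" "y \<le> x1" for y
      using max[of x1 y t1] that z1 by (auto simp: a_def)
    show False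
    proof (cases "y1 = 0")
      case True
      have "- (\<sigma> * ux 0 t1) + a * (4 * sr - 2 * x1) \<le> 0"
      proof (rule derivative_nonpos_at_left_endpoint_max)
        show "((\<lambda>y. \<sigma> * (u x1 t1 - u y t1) - a * g (x1 - y)) has_real_derivative
            - (\<sigma> * ux 0 t1) + a * (4 * sr - 2 * x1)) (at 0 within {0..s t1})"
          unfolding g_def using xy1 \<open>t1 > 0\<close>
          by (auto intro!: derivative_eq_intros u_x simp: algebra_simps)
      qed (use True \<open>y1 < x1\<close> xy1 max_y in auto)
      moreover have "a * (2 * sr) \<le> a * (4 * sr - 2 * x1)"
        using \<open>a > 0\<close> st1 xy1 by (intro mult_left_mono) auto
      ultimately have "a * (2 * sr) \<le> \<sigma> * ux 0 t1" by linarith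
      also have "\<dots> \<le> \<bar>ux 0 t1\<bar>" using \<sigma> by auto
      also have "\<dots> = Q t1 / \<beta>" using flux_Q[OF \<open>t1 > 0\<close>] Q_gt_0[OF t1] pos by simp
      finally have "a * (2 * sr) * \<beta> \<le> Q t1" using pos by (simp add: divide_simps)
      then show False using Q[OF t1] by (simp add: a_def mult_ac)
    next
      case False
      then have "y1 > 0" using xy1 by auto
      have "\<sigma> * uxx x1 t1 + 2 * a \<le> 0"
      proof (rule second_derivative_nonpos_at_max[OF \<open>y1 < x1\<close> \<open>x1 < s t1\<close>])
        show "((\<lambda>x. \<sigma> * (u x t1 - u y1 t1) - a * g (x - y1)) has_real_derivative
            \<sigma> * ux x t1 - a * (4 * sr - 2 * (x - y1))) (at x)" if "y1 < x" "x < s t1" for x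
          unfolding g_def using that \<open>t1 > 0\<close> \<open>y1 > 0\<close>
          by (auto intro!: derivative_eq_intros u_x_interior simp: algebra_simps)
        show "((\<lambda>x. \<sigma> * ux x t1 - a * (4 * sr - 2 * (x - y1))) has_real_derivative
            \<sigma> * uxx x1 t1 + 2 * a) (at x1)"
          using \<open>y1 > 0\<close> \<open>y1 < x1\<close> \<open>x1 < s t1\<close> \<open>t1 > 0\<close> by (auto intro!: derivative_eq_intros u_xx)
      qed (use max_x in auto)
      moreover have "- (\<sigma> * uxx y1 t1) + 2 * a \<le> 0"
      proof (rule second_derivative_nonpos_at_max[OF \<open>y1 > 0\<close> \<open>y1 < x1\<close>])
        show "((\<lambda>y. \<sigma> * (u x1 t1 - u y t1) - a * g (x1 - y)) has_real_derivative
            - (\<sigma> * ux y t1) + a * (4 * sr - 2 * (x1 - y))) (at y)" if "0 < y" "y < x1" for y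
          unfolding g_def using that \<open>t1 > 0\<close> xy1
          by (auto intro!: derivative_eq_intros u_x_interior simp: algebra_simps)
        show "((\<lambda>y. - (\<sigma> * ux y t1) + a * (4 * sr - 2 * (x1 - y))) has_real_derivative
            - (\<sigma> * uxx y1 t1) + 2 * a) (at y1)"
          using \<open>y1 > 0\<close> \<open>y1 < x1\<close> xy1 \<open>t1 > 0\<close> by (auto intro!: derivative_eq_intros u_xx)
      qed (use max_y in auto)
      \<comment> \<open>Each variable contributes \<open>2 * a\<close>; the total
        \<open>4 * a * \<alpha>\<close> exceeds the decay loss, which is at most
        \<open>a * \<alpha>\<close>.\<close>
      ultimately have "\<alpha> * (\<sigma> * (uxx x1 t1 - uxx y1 t1) + 4 * a) \<le> 0"
        using pos by (intro mult_nonneg_nonpos) (auto simp: algebra_simps)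
      obtain r0 where r0: "0 \<le> r0" "r0 < t1" "\<And>r. r0 < r \<Longrightarrow> r \<le> t1 \<Longrightarrow> x1 < s r"
        using inside_before[OF \<open>t1 > 0\<close> \<open>x1 < s t1\<close>] by blast
      let ?z = "x1 - y1"
      have z: "0 \<le> ?z" "?z \<le> sr" using xy1 st1 by auto
      have "0 \<le> \<sigma> * (\<alpha> * uxx x1 t1 - \<alpha> * uxx y1 t1) + b * a * g ?z"
      proof (rule derivative_nonneg_at_left_max[OF _ r0(2)])
        show "((\<lambda>r. \<sigma> * (u x1 r - u y1 r) - A * exp (- b * r) * g ?z) has_real_derivative
            \<sigma> * (\<alpha> * uxx x1 t1 - \<alpha> * uxx y1 t1) + b * a * g ?z) (at t1)"
          unfolding a_def using \<open>y1 > 0\<close> \<open>y1 < x1\<close> \<open>x1 < s t1\<close> \<open>t1 > 0\<close>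
          by (auto intro!: derivative_eq_intros heat)
        show "\<sigma> * (u x1 r - u y1 r) - A * exp (- b * r) * g ?z \<le>
            \<sigma> * (u x1 t1 - u y1 t1) - A * exp (- b * t1) * g ?z"
          if "r0 < r" "r < t1" for r
          using max[of x1 y1 r] r0(1) r0(3)[of r] that z1 xy1 by auto
      qed
      moreover have "b * a * g ?z \<le> b * a * (4 * sr\<^sup>2)"
        using b \<open>a > 0\<close> by (intro mult_left_mono g_upper z) auto
      moreover have "a * (4 * sr\<^sup>2 * b) \<le> a * \<alpha>"
        using b \<open>a > 0\<close> by (intro mult_left_mono) auto
      moreover have "0 < a * \<alpha>" using \<open>a > 0\<close> pos by simp
      ultimately show False
        using \<open>\<alpha> * (\<sigma> * (uxx x1 t1 - uxx y1 t1) + 4 * a) \<le> 0\<close> by (simp add: algebra_simps)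
    qed
  qed
  then show ?thesis using max[OF \<open>(x, y, t) \<in> ?S\<close>] by (simp add: a_def g_def)
qed

lemma lipschitz_decay:
  assumes b: "0 < b" "4 * sr\<^sup>2 * b \<le> \<alpha>" and A: "0 < A" "\<Lambda> \<le> 3 * sr * A"
    and lip: "\<And>x y. x \<in> {0..s 0} \<Longrightarrow> y \<in> {0..s 0} \<Longrightarrow> \<bar>u x 0 - u y 0\<bar> \<le> \<Lambda> * \<bar>x - y\<bar>"
    and Q: "\<And>t. t \<ge> 0 \<Longrightarrow> Q t < 2 * sr * \<beta> * A * exp (- b * t)"
    and t: "0 \<le> t" and xy: "x \<in> {0..s t}" "y \<in> {0..s t}"
  shows "\<bar>u x t - u y t\<bar> \<le> 4 * sr * A * exp (- b * t) * \<bar>x - y\<bar>"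
proof -
  have *: "\<bar>u x t - u y t\<bar> \<le> 4 * sr * A * exp (- b * t) * \<bar>x - y\<bar>"
    if "0 \<le> y" "y \<le> x" "x \<le> s t" for x y
  proof -
    have "\<sigma> * (u x t - u y t) \<le> A * exp (- b * t) * (4 * sr * (x - y) - (x - y)\<^sup>2)"
      if "\<sigma> \<in> {-1, 1}" for \<sigma>
      using that t \<open>0 \<le> y\<close> \<open>y \<le> x\<close> \<open>x \<le> s t\<close>
      by (intro modulus_of_continuity[OF b A] lip Q) auto
    from this[of 1] this[of "-1"]
    have "\<bar>u x t - u y t\<bar> \<le> A * exp (- b * t) * (4 * sr * (x - y) - (x - y)\<^sup>2)"
      by (simp add: abs_le_iff)
    also have "\<dots> \<le> A * exp (- b * t) * (4 * sr * (x - y))"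
      using A by (intro mult_left_mono) auto
    finally show ?thesis using that by (simp add: algebra_simps)
  qed
  show ?thesis
    using *[of y x] *[of x y] xy by (cases "y \<le> x") (auto simp: abs_minus_commute)
qed

end

subsection \<open>From Lipschitz decay to the transformed states\<close>

lemma abs_derivative_le_of_lipschitz:
  fixes f :: "real \<Rightarrow> real"
  assumes der: "(f has_real_derivative D) (at x within {a..b})" and "a < b" "x \<in> {a..b}"
    and lip: "\<And>y. y \<in> {a..b} \<Longrightarrow> \<bar>f y - f x\<bar> \<le> K * \<bar>y - x\<bar>"
  shows "\<bar>D\<bar> \<le> K"
proof (rule tendsto_upperbound)
  show "((\<lambda>y. \<bar>(f y - f x) / (y - x)\<bar>) \<longlongrightarrow> \<bar>D\<bar>) (at x within {a..b})"
    using der by (intro tendsto_rabs) (simp add: has_field_derivative_iff)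
  show "\<forall>\<^sub>F y in at x within {a..b}. \<bar>(f y - f x) / (y - x)\<bar> \<le> K"
    using lip by (auto simp: eventually_at_filter divide_simps)
  show "at x within {a..b} \<noteq> bot"
    using assms(2,3) by (simp add: trivial_limit_within islimpt_Icc)
qed

lemma L2_sq_le:
  assumes "0 \<le> \<sigma>" "0 \<le> B" "\<And>x. x \<in> {0..\<sigma>} \<Longrightarrow> \<bar>f x\<bar> \<le> B"
  shows "L2_sq \<sigma> f \<le> \<sigma> * B\<^sup>2"
proof (cases "(\<lambda>x. (f x)\<^sup>2) integrable_on {0..\<sigma>}")
  case True
  have "L2_sq \<sigma> f \<le> integral {0..\<sigma>} (\<lambda>_. B\<^sup>2)"
    unfolding L2_sq_def
  proof (rule integral_le[OF True])
    show "(f x)\<^sup>2 \<le> B\<^sup>2" if "x \<in> {0..\<sigma>}" for x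
      using power_mono[OF assms(3)[OF that], of 2] by simp
  qed (rule integrable_const_ivl)
  then show ?thesis using assms(1) by simp
next
  \<comment> \<open>A non-integrable integrand has integral 0 by convention, so the bound
    persists.\<close>
  case False
  then show ?thesis using assms(1) by (simp add: L2_sq_def not_integrable_integral)
qed

lemma L2_sq_nonneg: "0 \<le> L2_sq \<sigma> f"
  unfolding L2_sq_def
  by (cases "(\<lambda>x. (f x)\<^sup>2) integrable_on {0..\<sigma>}") (auto simp: integral_nonneg not_integrable_integral)

lemma X_state_inner: "X_state sr \<sigma> v \<bullet> X_state sr \<sigma> v = (\<sigma> - sr)\<^sup>2 + v\<^sup>2"
  by (simp add: X_state_def inner_vec_def sum_2 power2_eq_square)

text \<open>The kernel \<open>x - y\<close> vanishes at \<open>y = x\<close>, so the integral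
  contributes no term in \<open>\<theta> x\<close>. Splitting it through \<open>F\<close> and
  \<open>G\<close> reduces the derivative to the fundamental theorem of calculus.\<close>

lemma w_state_deriv:
  assumes "\<alpha> \<noteq> 0" "\<beta> \<noteq> 0" and \<theta>: "continuous_on {0..\<sigma>} \<theta>" and x: "x \<in> {0..\<sigma>}"
    and der: "(\<theta> has_real_derivative D) (at x within {0..\<sigma>})"
  shows "(w_state \<alpha> \<beta> \<epsilon> Tm sr c1 c2 \<theta> \<sigma> v has_real_derivative
    D - c2 / \<alpha> * integral {x..\<sigma>} (\<lambda>y. \<theta> y - Tm) - (c1 * (\<sigma> - sr) + \<epsilon> * c2 * v) / \<beta>) (at x within {0..\<sigma>})"
proof -
  define F G where "F x = integral {0..x} (\<lambda>y. \<theta> y - Tm)" and "G x = integral {0..x} (\<lambda>y. y * (\<theta> y - Tm))" for x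
  have c: "continuous_on {0..\<sigma>} (\<lambda>y. \<theta> y - Tm)" "continuous_on {0..\<sigma>} (\<lambda>y. y * (\<theta> y - Tm))"
    by (intro continuous_intros \<theta>)+
  have F: "(F has_real_derivative \<theta> x - Tm) (at x within {0..\<sigma>})"
    and G: "(G has_real_derivative x * (\<theta> x - Tm)) (at x within {0..\<sigma>})"
    unfolding F_def[abs_def] G_def[abs_def] has_real_derivative_iff_has_vector_derivative
    using x by (intro integral_has_vector_derivative c; simp)+
  have split: "integral {y..\<sigma>} (\<lambda>y. \<theta> y - Tm) = F \<sigma> - F y"
      "integral {y..\<sigma>} (\<lambda>z. (y - z) * (\<theta> z - Tm)) = y * (F \<sigma> - F y) - (G \<sigma> - G y)" if y: "y \<in> {0..\<sigma>}" for y
  proof -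
    have F': "integral {y..\<sigma>} (\<lambda>y. \<theta> y - Tm) = F \<sigma> - F y"
      and G': "integral {y..\<sigma>} (\<lambda>y. y * (\<theta> y - Tm)) = G \<sigma> - G y"
      using y c[THEN integrable_continuous_interval]
        Henstock_Kurzweil_Integration.integral_combine[of 0 y \<sigma> "\<lambda>y. \<theta> y - Tm"]
        Henstock_Kurzweil_Integration.integral_combine[of 0 y \<sigma> "\<lambda>y. y * (\<theta> y - Tm)"]
      by (auto simp: F_def G_def)
    have i: "(\<lambda>y. \<theta> y - Tm) integrable_on {y..\<sigma>}" "(\<lambda>y. y * (\<theta> y - Tm)) integrable_on {y..\<sigma>}"
      using y by (auto intro!: integrable_continuous_interval continuous_on_subset[OF c(1)] continuous_on_subset[OF c(2)])
    have "integral {y..\<sigma>} (\<lambda>z. y * (\<theta> z - Tm) - z * (\<theta> z - Tm)) =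
        y * integral {y..\<sigma>} (\<lambda>z. \<theta> z - Tm) - integral {y..\<sigma>} (\<lambda>z. z * (\<theta> z - Tm))"
      by (subst integral_diff) (auto intro!: integrable_on_mult_right i)
    then show "integral {y..\<sigma>} (\<lambda>z. (y - z) * (\<theta> z - Tm)) = y * (F \<sigma> - F y) - (G \<sigma> - G y)"
      unfolding F' G' by (simp only: left_diff_distrib)
    show "integral {y..\<sigma>} (\<lambda>y. \<theta> y - Tm) = F \<sigma> - F y" by (rule F')
  qed
  let ?m = "c1 * (\<sigma> - sr) + \<epsilon> * c2 * v"
  have "((\<lambda>y. (\<theta> y - Tm) - c2 / \<alpha> * (y * (F \<sigma> - F y) - (G \<sigma> - G y)) - (y - \<sigma>) / \<beta> * ?m) has_real_derivative
      D - c2 / \<alpha> * (F \<sigma> - F x) - ?m / \<beta>) (at x within {0..\<sigma>})"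
    using \<open>\<alpha> \<noteq> 0\<close> \<open>\<beta> \<noteq> 0\<close> by (auto intro!: derivative_eq_intros der F G simp: field_simps)
  then show ?thesis
    unfolding has_field_derivative_def split(1)[OF x]
    by (rule has_derivative_transform[OF x, rotated]) (simp_all add: w_state_def split(2))
qed

text \<open>\<open>\<theta> - Tm\<close> vanishes at \<open>\<sigma>\<close>, so the Lipschitz bound
  gives \<open>d * R\<close> for its size and \<open>d\<close> for its slope. With the gap and the
  velocity also of size \<open>d\<close>, \<open>w\<close> and its derivative are pointwise of order
  \<open>d\<close>, and \<open>Phi\<close> is quadratic in them; the final 2 comes from
  \<open>X\<close>.\<close>

lemma Phi_le:
  assumes pos: "\<alpha> > 0" "\<beta> > 0" "\<epsilon> > 0" "c1 > 0" "c2 > 0" and \<sigma>: "0 < \<sigma>" "\<sigma> \<le> R" and "0 \<le> d"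
    and diff: "\<theta> differentiable_on {0..\<sigma>}" and bdry: "\<theta> \<sigma> = Tm"
    and lip: "\<And>x y. x \<in> {0..\<sigma>} \<Longrightarrow> y \<in> {0..\<sigma>} \<Longrightarrow> \<bar>\<theta> x - \<theta> y\<bar> \<le> d * \<bar>x - y\<bar>"
    and X: "\<bar>\<sigma> - sr\<bar> \<le> d" "\<bar>v\<bar> \<le> d"
  shows "Phi \<alpha> \<beta> \<epsilon> Tm sr c1 c2 \<theta> \<sigma> v \<le>
    (R * (R + c2 / \<alpha> * R^3 + R * (c1 + \<epsilon> * c2) / \<beta>)\<^sup>2 + R * (1 + c2 / \<alpha> * R\<^sup>2 + (c1 + \<epsilon> * c2) / \<beta>)\<^sup>2 + 2) * d\<^sup>2"
proof -
  let ?w = "w_state \<alpha> \<beta> \<epsilon> Tm sr c1 c2 \<theta> \<sigma> v"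
  let ?W0 = "R + c2 / \<alpha> * R^3 + R * (c1 + \<epsilon> * c2) / \<beta>"
  let ?W1 = "1 + c2 / \<alpha> * R\<^sup>2 + (c1 + \<epsilon> * c2) / \<beta>"
  let ?m = "c1 * (\<sigma> - sr) + \<epsilon> * c2 * v"
  have "R > 0" using \<sigma> by simp
  have cont: "continuous_on {0..\<sigma>} \<theta>" using diff by (rule differentiable_imp_continuous_on)
  have \<theta>: "\<bar>\<theta> y - Tm\<bar> \<le> d * R" if "y \<in> {0..\<sigma>}" for y
  proof -
    have "\<bar>\<theta> y - Tm\<bar> \<le> d * \<bar>y - \<sigma>\<bar>" using lip[of y \<sigma>] that bdry by auto
    also have "\<dots> \<le> d * R" using that \<sigma> \<open>0 \<le> d\<close> by (intro mult_left_mono) auto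
    finally show ?thesis .
  qed
  have m: "\<bar>?m\<bar> \<le> (c1 + \<epsilon> * c2) * d"
  proof -
    have "\<bar>?m\<bar> \<le> c1 * \<bar>\<sigma> - sr\<bar> + \<epsilon> * c2 * \<bar>v\<bar>"
      using pos abs_triangle_ineq[of "c1 * (\<sigma> - sr)" "\<epsilon> * c2 * v"] by (simp add: abs_mult)
    also have "\<dots> \<le> c1 * d + \<epsilon> * c2 * d" using X pos by (intro add_mono mult_left_mono) auto
    finally show ?thesis by (simp add: algebra_simps)
  qed
  have w: "\<bar>?w x\<bar> \<le> ?W0 * d" if x: "x \<in> {0..\<sigma>}" for x
  proof -
    have "norm (integral {x..\<sigma>} (\<lambda>y. (x - y) * (\<theta> y - Tm))) \<le> (R * (d * R)) * (\<sigma> - x)"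
    proof (rule integral_bound)
      show "continuous_on {x..\<sigma>} (\<lambda>y. (x - y) * (\<theta> y - Tm))"
        using x by (intro continuous_intros continuous_on_subset[OF cont]) auto
      show "norm ((x - y) * (\<theta> y - Tm)) \<le> R * (d * R)" if "y \<in> {x..\<sigma>}" for y
        unfolding real_norm_def abs_mult using that x \<sigma> \<open>0 \<le> d\<close> by (intro mult_mono \<theta>) auto
    qed (use x in auto)
    also have "\<dots> \<le> (R * (d * R)) * R" using x \<sigma> \<open>0 \<le> d\<close> by (intro mult_left_mono) auto
    finally have "c2 / \<alpha> * \<bar>integral {x..\<sigma>} (\<lambda>y. (x - y) * (\<theta> y - Tm))\<bar> \<le> c2 / \<alpha> * ((R * (d * R)) * R)"
      using pos by (intro mult_left_mono) auto
    then have 1: "\<bar>c2 / \<alpha> * integral {x..\<sigma>} (\<lambda>y. (x - y) * (\<theta> y - Tm))\<bar> \<le> c2 / \<alpha> * R^3 * d"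
      using pos by (simp add: abs_mult power3_eq_cube mult_ac)
    have "\<bar>(x - \<sigma>) / \<beta> * ?m\<bar> = \<bar>x - \<sigma>\<bar> / \<beta> * \<bar>?m\<bar>" using pos by (simp add: abs_mult)
    also have "\<dots> \<le> R / \<beta> * ((c1 + \<epsilon> * c2) * d)"
      using x \<sigma> pos m by (intro mult_mono divide_right_mono) auto
    finally have 2: "\<bar>(x - \<sigma>) / \<beta> * ?m\<bar> \<le> R * (c1 + \<epsilon> * c2) / \<beta> * d" by simp
    have "\<bar>?w x\<bar> \<le> d * R + c2 / \<alpha> * R^3 * d + R * (c1 + \<epsilon> * c2) / \<beta> * d"
      unfolding w_state_def using 1 2 \<theta>[OF x] by linarith
    then show ?thesis by (simp add: algebra_simps)
  qed
  have w': "\<bar>vector_derivative ?w (at x within {0..\<sigma>})\<bar> \<le> ?W1 * d" if x: "x \<in> {0..\<sigma>}" for x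
  proof -
    obtain D where D: "(\<theta> has_real_derivative D) (at x within {0..\<sigma>})"
      using diff x unfolding differentiable_on_def real_differentiable_def by blast
    have "\<bar>D\<bar> \<le> d"
      using lip x \<sigma> by (intro abs_derivative_le_of_lipschitz[OF D]) auto
    moreover have "norm (integral {x..\<sigma>} (\<lambda>y. \<theta> y - Tm)) \<le> (d * R) * (\<sigma> - x)"
      using x by (intro integral_bound continuous_intros continuous_on_subset[OF cont]) (auto intro!: \<theta>)
    moreover have "(d * R) * (\<sigma> - x) \<le> (d * R) * R" using x \<sigma> \<open>0 \<le> d\<close> by (intro mult_left_mono) auto
    ultimately have "c2 / \<alpha> * \<bar>integral {x..\<sigma>} (\<lambda>y. \<theta> y - Tm)\<bar> \<le> c2 / \<alpha> * ((d * R) * R)"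
      using pos by (intro mult_left_mono) auto
    then have 1: "\<bar>c2 / \<alpha> * integral {x..\<sigma>} (\<lambda>y. \<theta> y - Tm)\<bar> \<le> c2 / \<alpha> * R\<^sup>2 * d"
      using pos by (simp add: abs_mult power2_eq_square mult_ac)
    have 2: "\<bar>?m / \<beta>\<bar> \<le> (c1 + \<epsilon> * c2) / \<beta> * d" using m pos by (simp add: divide_right_mono)
    have "vector_derivative ?w (at x within {0..\<sigma>}) = D - c2 / \<alpha> * integral {x..\<sigma>} (\<lambda>y. \<theta> y - Tm) - ?m / \<beta>"
      using w_state_deriv[OF _ _ cont x D] x \<sigma> pos
      by (intro vector_derivative_within_closed_interval)
        (auto simp: has_real_derivative_iff_has_vector_derivative)
    moreover have "\<bar>p - q - r\<bar> \<le> p' + q' + r'" if "\<bar>p\<bar> \<le> p'" "\<bar>q\<bar> \<le> q'" "\<bar>r\<bar> \<le> r'" for p q r p' q' r' :: real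
      using that by linarith
    ultimately have "\<bar>vector_derivative ?w (at x within {0..\<sigma>})\<bar> \<le> d + c2 / \<alpha> * R\<^sup>2 * d + (c1 + \<epsilon> * c2) / \<beta> * d"
      using 1 2 \<open>\<bar>D\<bar> \<le> d\<close> by presburger
    then show ?thesis by (simp add: algebra_simps)
  qed
  have W: "0 \<le> ?W0 * d" "0 \<le> ?W1 * d" using pos \<open>R > 0\<close> \<open>0 \<le> d\<close> by auto
  have "L2_sq \<sigma> ?w \<le> R * (?W0 * d)\<^sup>2"
    by (rule order_trans[OF L2_sq_le[OF _ W(1) w] mult_right_mono]) (use \<sigma> in auto)
  moreover have "L2_sq \<sigma> (\<lambda>x. vector_derivative ?w (at x within {0..\<sigma>})) \<le> R * (?W1 * d)\<^sup>2"
    by (rule order_trans[OF L2_sq_le[OF _ W(2) w'] mult_right_mono]) (use \<sigma> in auto)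
  moreover have "X_state sr \<sigma> v \<bullet> X_state sr \<sigma> v \<le> d\<^sup>2 + d\<^sup>2"
    unfolding X_state_inner using X \<open>0 \<le> d\<close> by (intro add_mono) (auto simp: abs_le_square_iff[symmetric])
  ultimately show ?thesis
    unfolding Phi_def Let_def power_mult_distrib by (simp only: distrib_right mult.assoc)
qed

section \<open>From classical solutions to the abstract system\<close>

lemma solution_initial_profile:
  assumes sol: "closed_loop_solution \<alpha> \<beta> k \<epsilon> Tm sr c1 c2 s0 v0 T0 T s"
    and s0: "0 < s0" and T0: "continuous_on {0..s0} T0" and x: "x \<in> {0..s0}"
  shows "T x 0 = T0 x"
proof -
  have cont: "continuous_on {(x, t). 0 \<le> t \<and> 0 \<le> x \<and> x \<le> s t} (\<lambda>(x, t). T x t)"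
    and "s 0 = s0" and eq: "\<And>x. x \<in> {0<..s0} \<Longrightarrow> T x 0 = T0 x"
    using sol by (auto simp: closed_loop_solution_def classical_regularity_def)
  have "continuous_on {0..s0} (\<lambda>x. (\<lambda>(x, t). T x t) (x, 0))"
    using \<open>s 0 = s0\<close> by (intro continuous_on_compose2[OF cont] continuous_intros) auto
  \<comment> \<open>The initial condition is imposed on \<open>(0, s0]\<close> only; continuity
    carries it to \<open>x = 0\<close>.\<close>
  then have "continuous_on (closure {0<..s0}) (\<lambda>x. T x 0 - T0 x)"
    using s0 T0 by (auto intro!: continuous_intros)
  then have "T x 0 - T0 x = 0"
    by (rule continuous_constant_on_closure) (use eq s0 x in auto)
  then show ?thesis by simp
qed

text \<open>The hypothesis \<open>gain\<close> is \<open>0 < Q 0\<close> in terms of the initial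
  data. Classical regularity supplies the differentiability that turns each
  \<open>vector_derivative\<close> into an actual derivative.\<close>

lemma closed_loop_solution_stable:
  assumes pos: "\<alpha> > 0" "\<beta> > 0" "k > 0" "\<epsilon> > 0" "0 < c1" "c1 \<le> c2" and s0: "0 < s0"
    and T0: "continuous_on {0..s0} T0" "\<And>x. x \<in> {0..s0} \<Longrightarrow> Tm \<le> T0 x" "T0 s0 = Tm"
    and v0: "0 \<le> v0"
    and gain: "0 < c1 * (sr - s0) - c2 * (\<beta> / \<alpha> * integral {0..s0} (\<lambda>x. T0 x - Tm) + \<epsilon> * v0)"
    and sol: "closed_loop_solution \<alpha> \<beta> k \<epsilon> Tm sr c1 c2 s0 v0 T0 T s"
  shows "stable_stefan \<alpha> \<beta> \<epsilon> c1 c2 sr (\<lambda>x t. T x t - Tm) (T_x T s) (T_xx T s) s (sdot s)"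
proof -
  note init = solution_initial_profile[OF sol s0 T0(1)]
  have reg: "classical_regularity T s"
    and heat: "\<And>t x. t > 0 \<Longrightarrow> 0 < x \<Longrightarrow> x < s t \<Longrightarrow> T_t T x t = \<alpha> * T_xx T s x t"
    and flux: "\<And>t. t > 0 \<Longrightarrow> - k * T_x T s 0 t = heat_control \<alpha> \<beta> k \<epsilon> Tm sr c1 c2 T s t"
    and melt: "\<And>t. t > 0 \<Longrightarrow> T (s t) t = Tm"
    and ode: "\<And>t. t > 0 \<Longrightarrow> \<epsilon> * sddot s t = - sdot s t - \<beta> * T_x T s (s t) t"
    and s_0: "s 0 = s0" and v_0: "sdot s 0 = v0"
    using sol unfolding closed_loop_solution_def by auto
  have C1: "C1_on {0..} s" "C1_on {0<..} (sdot s)"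
    and T_cont: "continuous_on {(x, t). 0 \<le> t \<and> 0 \<le> x \<and> x \<le> s t} (\<lambda>(x, t). T x t)"
    and T_t: "\<And>t x. t > 0 \<Longrightarrow> 0 < x \<Longrightarrow> x < s t \<Longrightarrow> (\<lambda>r. T x r) differentiable (at t)"
    and T_x: "\<And>t. t > 0 \<Longrightarrow> (\<lambda>y. T y t) differentiable_on {0..s t}"
    and T_xx: "\<And>t x. t > 0 \<Longrightarrow> 0 < x \<Longrightarrow> x < s t \<Longrightarrow> (\<lambda>y. T_x T s y t) differentiable (at x)"
    using reg unfolding classical_regularity_def by auto
  have s_pos: "s t > 0" if "t \<ge> 0" for t
    using reg that unfolding classical_regularity_def by auto
  have E0: "integral {0..s0} (\<lambda>x. T x 0 - Tm) = integral {0..s0} (\<lambda>x. T0 x - Tm)"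
    using init by (intro integral_cong) auto
  have L: "relaxed_stefan \<alpha> \<beta> \<epsilon> c1 c2 sr (\<lambda>x t. T x t - Tm) (T_x T s) (T_xx T s) s (sdot s)"
  proof
    fix t :: real assume t: "t \<ge> 0"
    show "(s has_real_derivative sdot s t) (at t within {0..})"
      using C1(1) t unfolding C1_on_def differentiable_on_def sdot_def
      by (auto simp: has_real_derivative_iff_has_vector_derivative vector_derivative_works[symmetric])
    \<comment> \<open>The melting condition is posed for positive times; at time 0 it comes from
      \<open>T0 s0 = Tm\<close>.\<close>
    show "T (s t) t - Tm = 0"
      using melt[of t] init[of s0] s0 T0(3) s_0 t by (cases "t = 0") auto
  next
    show "continuous_on {0..} (sdot s)"
      using C1(1) unfolding C1_on_def sdot_def[abs_def] by auto
  next
    fix t :: real assume t: "t > 0"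
    have "sdot s differentiable (at t within {0<..})"
      using C1(2) t unfolding C1_on_def differentiable_on_def by auto
    then have "sdot s differentiable (at t)"
      using t by (simp add: at_within_open[of t "{0<..}"])
    then have "(sdot s has_real_derivative sddot s t) (at t)"
      unfolding sddot_def
      by (simp add: has_real_derivative_iff_has_vector_derivative vector_derivative_works[symmetric])
    moreover have "sddot s t = (- sdot s t - \<beta> * T_x T s (s t) t) / \<epsilon>"
      using ode[OF t] pos by (simp add: field_simps)
    ultimately show "(sdot s has_real_derivative (- sdot s t - \<beta> * T_x T s (s t) t) / \<epsilon>) (at t)" by simp
  next
    show "continuous_on {(x, t). 0 \<le> t \<and> 0 \<le> x \<and> x \<le> s t} (\<lambda>(x, t). T x t - Tm)"
      using T_cont unfolding case_prod_unfold by (intro continuous_intros) auto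
  next
    fix x t :: real assume *: "t > 0" "0 < x" "x < s t"
    have "((\<lambda>r. T x r) has_real_derivative \<alpha> * T_xx T s x t) (at t)"
      using T_t[OF *] unfolding heat[OF *, symmetric] T_t_def
      by (simp add: has_real_derivative_iff_has_vector_derivative vector_derivative_works[symmetric])
    then show "((\<lambda>r. T x r - Tm) has_real_derivative \<alpha> * T_xx T s x t) (at t)"
      by (auto intro!: derivative_eq_intros)
    show "((\<lambda>y. T_x T s y t) has_real_derivative T_xx T s x t) (at x)"
      using T_xx[OF *] unfolding T_xx_def
      by (simp add: has_real_derivative_iff_has_vector_derivative vector_derivative_works[symmetric])
  next
    fix x t :: real assume *: "t > 0" "0 \<le> x" "x \<le> s t"
    have "((\<lambda>y. T y t) has_real_derivative T_x T s x t) (at x within {0..s t})"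
      using T_x[OF *(1)] * unfolding differentiable_on_def T_x_def
      by (auto simp: has_real_derivative_iff_has_vector_derivative vector_derivative_works[symmetric])
    then show "((\<lambda>y. T y t - Tm) has_real_derivative T_x T s x t) (at x within {0..s t})"
      by (auto intro!: derivative_eq_intros)
  next
    fix t :: real assume t: "t > 0"
    have "k * T_x T s 0 t = k * (c2 / \<alpha> * integral {0..s t} (\<lambda>x. T x t - Tm) +
        (c1 * (s t - sr) + c2 * \<epsilon> * sdot s t) / \<beta>)"
      using flux[OF t] unfolding heat_control_def
      by (simp add: algebra_simps add_divide_distrib diff_divide_distrib)
    then show "T_x T s 0 t = c2 / \<alpha> * integral {0..s t} (\<lambda>x. T x t - Tm) +
        (c1 * (s t - sr) + c2 * \<epsilon> * sdot s t) / \<beta>"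
      using pos by (simp only: mult_cancel_left) simp
  qed (use reg pos s_pos in \<open>auto simp: classical_regularity_def\<close>)
  interpret relaxed_stefan \<alpha> \<beta> \<epsilon> c1 c2 sr "\<lambda>x t. T x t - Tm" "T_x T s" "T_xx T s" s "sdot s"
    by (rule L)
  show ?thesis
  proof
    show "0 \<le> T x 0 - Tm" if "x \<in> {0..s 0}" for x
      using that init[of x] T0(2)[of x] s_0 by auto
    show "0 \<le> sdot s 0" using v_0 v0 by simp
    show "0 < Q 0" using gain unfolding Q_def E_def E0 v_0 s_0 .
  qed
qed

section \<open>Initial data, gain bound and choice of constants\<close>

lemma C1_on_lipschitz:
  assumes "C1_on {a..b} f"
  obtains K where "0 \<le> K" "\<And>x y. x \<in> {a..b} \<Longrightarrow> y \<in> {a..b} \<Longrightarrow> \<bar>f x - f y\<bar> \<le> K * \<bar>x - y\<bar>"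
proof -
  let ?f' = "\<lambda>x. vector_derivative f (at x within {a..b})"
  have "bounded (?f' ` {a..b})"
    using assms unfolding C1_on_def
    by (intro compact_imp_bounded compact_continuous_image) auto
  then obtain K where K: "0 < K" "\<And>x. x \<in> {a..b} \<Longrightarrow> \<bar>?f' x\<bar> \<le> K"
    unfolding bounded_pos by auto
  have "norm (f x - f y) \<le> K * norm (x - y)" if "x \<in> {a..b}" "y \<in> {a..b}" for x y
  proof (rule field_differentiable_bound[of "{a..b}" f ?f'])
    show "(f has_real_derivative ?f' z) (at z within {a..b})" if "z \<in> {a..b}" for z
      using assms that unfolding C1_on_def differentiable_on_def
      by (auto simp: has_real_derivative_iff_has_vector_derivative vector_derivative_works[symmetric])
  qed (use K that in auto)
  with K(1) show thesis by (intro that[of K]) auto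
qed

text \<open>For \<open>sl \<noteq> s0\<close> the bound equals
  \<open>c1 * (sr - s0) / (sl - s0)\<close>, so multiplying by \<open>sl - s0\<close> gives the
  claim; for \<open>sl = s0\<close> the gain term vanishes. The conclusion is the initial positivity
  of \<open>Q\<close>.\<close>

lemma gain_condition:
  assumes "0 < c1" "s0 \<le> sl" "sl < sr" "ereal c2 < ereal c1 + c2_bar c1 sr sl s0"
  shows "0 < c1 * (sr - s0) - c2 * (sl - s0)"
proof (cases "sl = s0")
  case True
  then show ?thesis using assms by simp
next
  case False
  then have "c2 < c1 + c1 * ((sr - sl) / (sl - s0))" using assms(4) by (simp add: c2_bar_def)
  then have "c2 * (sl - s0) < (c1 + c1 * ((sr - sl) / (sl - s0))) * (sl - s0)"
    using False assms(2) by (intro mult_strict_right_mono) auto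
  also have "\<dots> = c1 * (sr - s0)" using False by (simp add: field_simps)
  finally show ?thesis by simp
qed

theorem theorem1:
  fixes \<alpha> \<beta> k \<epsilon> L Tm s0 v0 sr c1 c2 :: real and T0 :: "real \<Rightarrow> real"
  assumes "\<alpha> > 0" "\<beta> > 0" "k > 0" "\<epsilon> > 0" "L > 0"
    and "0 < s0" "s0 < L"
    and "C1_on {0..s0} T0" "T0 ` {0..s0} \<subseteq> {Tm..}" "T0 s0 = Tm"
    and "v0 \<ge> 0"
    and "sr > sr_lower \<alpha> \<beta> \<epsilon> Tm s0 v0 T0"
    and "0 < c1" "c1 \<le> c2"
    and "ereal c2 <
      (if 12 * sr\<^sup>2 \<le> \<alpha> * \<epsilon>
       then ereal c1 + c2_bar c1 sr (sr_lower \<alpha> \<beta> \<epsilon> Tm s0 v0 T0) s0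
       else ereal c1 + c2_barbar \<alpha> \<epsilon> c1 sr (sr_lower \<alpha> \<beta> \<epsilon> Tm s0 v0 T0) s0)"
  shows "\<exists>M>0. \<exists>b>0. \<forall>T s.
    closed_loop_solution \<alpha> \<beta> k \<epsilon> Tm sr c1 c2 s0 v0 T0 T s \<longrightarrow>
    (\<forall>t\<ge>0. Phi \<alpha> \<beta> \<epsilon> Tm sr c1 c2 (\<lambda>x. T x t) (s t) (sdot s t)
            \<le> M * Phi \<alpha> \<beta> \<epsilon> Tm sr c1 c2 T0 s0 v0 * exp (- b * t))"
proof -
  define sl where "sl = sr_lower \<alpha> \<beta> \<epsilon> Tm s0 v0 T0"
  define e0 where "e0 = integral {0..s0} (\<lambda>x. T0 x - Tm)"
  have T0_diff: "T0 differentiable_on {0..s0}" using assms(8) by (simp add: C1_on_def)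
  then have T0_cont: "continuous_on {0..s0} T0" by (rule differentiable_imp_continuous_on)
  have T0_ge: "Tm \<le> T0 x" if "x \<in> {0..s0}" for x using assms(9) that by (auto simp: image_subset_iff)
  have "e0 \<ge> 0"
    unfolding e0_def
    by (intro integral_nonneg integrable_continuous_interval continuous_intros T0_cont) (use T0_ge in auto)
  have sl: "sl = s0 + \<epsilon> * v0 + \<beta> / \<alpha> * e0" by (simp add: sl_def sr_lower_def e0_def)
  have "s0 \<le> sl" using assms \<open>e0 \<ge> 0\<close> by (simp add: sl)
  have "sl < sr" using assms by (simp add: sl_def)
  then have "sr > 0" "s0 < sr" using \<open>s0 \<le> sl\<close> assms by auto
  \<comment> \<open>By the minimum in \<open>c2_barbar\<close>, either branch of the gain bound is
    at most \<open>c1 + c2_bar\<close>.\<close>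
  have "ereal c2 < ereal c1 + c2_bar c1 sr sl s0"
  proof -
    have "ereal c1 + c2_barbar \<alpha> \<epsilon> c1 sr sl s0 \<le> ereal c1 + c2_bar c1 sr sl s0"
      unfolding c2_barbar_def by (intro add_left_mono) simp
    then show ?thesis using assms(15) unfolding sl_def by (auto split: if_splits)
  qed
  from gain_condition[OF \<open>0 < c1\<close> \<open>s0 \<le> sl\<close> \<open>sl < sr\<close> this]
  have gain: "0 < c1 * (sr - s0) - c2 * (\<beta> / \<alpha> * e0 + \<epsilon> * v0)" by (simp add: sl algebra_simps)
  obtain \<Lambda> where \<Lambda>: "0 \<le> \<Lambda>" "\<And>x y. x \<in> {0..s0} \<Longrightarrow> y \<in> {0..s0} \<Longrightarrow> \<bar>T0 x - T0 y\<bar> \<le> \<Lambda> * \<bar>x - y\<bar>"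
    using C1_on_lipschitz[OF assms(8)] by blast
  have "c2 > 0" using assms by simp
  define \<kappa> where "\<kappa> = lyapunov_const \<alpha> \<epsilon> c1 c2 sr"
  have "\<kappa> > 0" unfolding \<kappa>_def using assms by (intro lyapunov_const_pos) auto
  \<comment> \<open>The initial value of \<open>v + Q + 2 * \<beta> * E\<close> in terms of the
    data, hence common to all solutions.\<close>
  define m where "m = v0 + (c1 * (sr - s0) - c2 * (\<beta> / \<alpha> * e0 + \<epsilon> * v0)) + 2 * \<beta> * e0"
  have "m > 0" unfolding m_def using gain \<open>e0 \<ge> 0\<close> assms by (intro add_pos_nonneg add_nonneg_pos) auto
  \<comment> \<open>The first entry is the Lyapunov rate, the second the supersolution condition on
    the comparison function.\<close>
  define b where "b = min (1 / \<kappa>) (\<alpha> / (4 * sr\<^sup>2))"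
  have b: "0 < b" "4 * sr\<^sup>2 * b \<le> \<alpha>" "b \<le> 1 / \<kappa>"
  proof -
    show "0 < b" using \<open>\<kappa> > 0\<close> \<open>sr > 0\<close> assms by (simp add: b_def)
    show "b \<le> 1 / \<kappa>" by (simp add: b_def)
    have "4 * sr\<^sup>2 * b \<le> 4 * sr\<^sup>2 * (\<alpha> / (4 * sr\<^sup>2))" by (intro mult_left_mono) (auto simp: b_def)
    then show "4 * sr\<^sup>2 * b \<le> \<alpha>" using \<open>sr > 0\<close> by simp
  qed
  \<comment> \<open>The first summand dominates the initial Lipschitz constant, the second the
    boundary flux, and 1 makes the latter bound strict.\<close>
  define A where "A = \<Lambda> / (3 * sr) + c2 * (\<kappa> * m) / (2 * sr * \<beta>) + 1"
  have A: "0 < A" "\<Lambda> \<le> 3 * sr * A" "c2 * (\<kappa> * m) < 2 * sr * \<beta> * A"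
  proof -
    have "0 \<le> \<Lambda> / (3 * sr)" "0 \<le> c2 * (\<kappa> * m) / (2 * sr * \<beta>)"
      using \<Lambda>(1) \<open>sr > 0\<close> \<open>\<kappa> > 0\<close> \<open>m > 0\<close> \<open>c2 > 0\<close> assms by auto
    then have "0 < A" "\<Lambda> / (3 * sr) \<le> A" "c2 * (\<kappa> * m) / (2 * sr * \<beta>) < A" by (auto simp: A_def)
    then show "0 < A" "\<Lambda> \<le> 3 * sr * A" "c2 * (\<kappa> * m) < 2 * sr * \<beta> * A"
      using \<open>sr > 0\<close> assms by (auto simp: divide_simps mult_ac)
  qed
  \<comment> \<open>The amplitudes of the slope, the velocity and the gap, in this order.\<close>
  define N where "N = max (4 * sr * A) (max (\<kappa> * m / \<epsilon>) (3 * c2 * (\<kappa> * m) / c1))"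
  have N: "4 * sr * A \<le> N" "\<kappa> * m / \<epsilon> \<le> N" "3 * c2 * (\<kappa> * m) / c1 \<le> N" by (auto simp: N_def)
  have "N > 0" using N(1) A(1) \<open>sr > 0\<close> by (smt (verit) mult_pos_pos)
  define C where "C = sr * (sr + c2 / \<alpha> * sr^3 + sr * (c1 + \<epsilon> * c2) / \<beta>)\<^sup>2
    + sr * (1 + c2 / \<alpha> * sr\<^sup>2 + (c1 + \<epsilon> * c2) / \<beta>)\<^sup>2 + 2"
  have "C > 0" unfolding C_def using \<open>sr > 0\<close> by (intro add_nonneg_pos add_nonneg_nonneg) auto
  let ?\<Phi>0 = "Phi \<alpha> \<beta> \<epsilon> Tm sr c1 c2 T0 s0 v0"
  have "?\<Phi>0 > 0"
    unfolding Phi_def Let_def X_state_inner using \<open>s0 < sr\<close>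
    by (intro add_nonneg_pos add_nonneg_nonneg L2_sq_nonneg add_pos_nonneg) auto
  \<comment> \<open>All constants are built from the data before \<open>T\<close> and
    \<open>s\<close> are fixed, so they serve every solution.\<close>
  show ?thesis
  proof (intro exI conjI allI impI)
    show "0 < C * N\<^sup>2 / ?\<Phi>0" using \<open>C > 0\<close> \<open>N > 0\<close> \<open>?\<Phi>0 > 0\<close> by simp
    show "0 < b" by (rule b(1))
    fix T s t
    assume sol: "closed_loop_solution \<alpha> \<beta> k \<epsilon> Tm sr c1 c2 s0 v0 T0 T s" and t: "(0::real) \<le> t"
    note init = solution_initial_profile[OF sol \<open>0 < s0\<close> T0_cont]
    interpret stable_stefan \<alpha> \<beta> \<epsilon> c1 c2 sr "\<lambda>x t. T x t - Tm" "T_x T s" "T_xx T s" s "sdot s"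
      using assms gain sol T0_cont T0_ge unfolding e0_def by (intro closed_loop_solution_stable) auto
    have s_0: "s 0 = s0" and v_0: "sdot s 0 = v0"
      and T_diff: "\<And>t. t > 0 \<Longrightarrow> (\<lambda>y. T y t) differentiable_on {0..s t}"
      using sol unfolding closed_loop_solution_def classical_regularity_def by auto
    have "E 0 = e0"
      unfolding E_def e0_def s_0 using init by (intro integral_cong) auto
    then have m: "sdot s 0 + Q 0 + 2 * \<beta> * E 0 \<le> m" by (simp add: m_def Q_def s_0 v_0)
    have exp_le: "exp (- r / \<kappa>) \<le> exp (- b * r)" if "0 \<le> r" for r
      using mult_right_mono[OF b(3) that] by simp
    have Q: "Q r < 2 * sr * \<beta> * A * exp (- b * r)" if r: "0 \<le> r" for r
    proof -
      have "Q r \<le> c2 * (\<kappa> * m) * exp (- r / \<kappa>)"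
        using mass_decay(2)[OF r m] by (simp add: \<kappa>_def mult.assoc)
      also have "\<dots> \<le> c2 * (\<kappa> * m) * exp (- b * r)"
        using exp_le[OF r] \<open>c2 > 0\<close> \<open>\<kappa> > 0\<close> \<open>m > 0\<close> by (intro mult_left_mono) auto
      also have "\<dots> < 2 * sr * \<beta> * A * exp (- b * r)" using A(3) by (intro mult_strict_right_mono) auto
      finally show ?thesis .
    qed
    define d where "d = N * exp (- b * t)"
    have d: "c * exp (- t / \<kappa>) \<le> d" if "0 \<le> c" "c \<le> N" for c
      unfolding d_def using that exp_le[OF t] by (intro mult_mono) auto
    have "Phi \<alpha> \<beta> \<epsilon> Tm sr c1 c2 (\<lambda>x. T x t) (s t) (sdot s t) \<le> C * d\<^sup>2"
      unfolding C_def
    proof (rule Phi_le)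
      show "0 < s t" "s t \<le> sr" using s_pos[OF t] s_less_sr[OF t] by auto
      show "0 \<le> d" using \<open>N > 0\<close> by (simp add: d_def)
      show "(\<lambda>x. T x t) differentiable_on {0..s t}"
      proof (cases "t = 0")
        \<comment> \<open>Regularity gives differentiability in \<open>x\<close> for positive times;
          at time 0 it is inherited from \<open>T0\<close>.\<close>
        case True
        show ?thesis
          using T0_diff init unfolding True s_0 differentiable_on_def
          by (metis differentiable_transform_within zero_less_one)
      qed (use T_diff t in auto)
      show "T (s t) t = Tm" using u_boundary[OF t] by simp
      show "\<bar>T x t - T y t\<bar> \<le> d * \<bar>x - y\<bar>" if "x \<in> {0..s t}" "y \<in> {0..s t}" for x y
      proof -
        have "\<bar>(T x t - Tm) - (T y t - Tm)\<bar> \<le> 4 * sr * A * exp (- b * t) * \<bar>x - y\<bar>"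
        proof (rule lipschitz_decay[OF b(1,2) A(1,2) _ Q t that])
          show "\<bar>T x 0 - Tm - (T y 0 - Tm)\<bar> \<le> \<Lambda> * \<bar>x - y\<bar>" if "x \<in> {0..s 0}" "y \<in> {0..s 0}" for x y
            using \<Lambda>(2)[of x y] init that s_0 by auto
        qed
        also have "\<dots> \<le> d * \<bar>x - y\<bar>" unfolding d_def using N(1) by (intro mult_right_mono) auto
        finally show ?thesis by simp
      qed
      have "c1 * (sr - s t) \<le> c1 * (3 * c2 * (\<kappa> * m) / c1 * exp (- t / \<kappa>))"
        using mass_decay(3)[OF t m] assms by (simp add: \<kappa>_def mult.assoc)
      then have "sr - s t \<le> 3 * c2 * (\<kappa> * m) / c1 * exp (- t / \<kappa>)" using assms by (simp only: mult_le_cancel_left_pos)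
      also have "\<dots> \<le> d" using N(3) \<open>c2 > 0\<close> \<open>\<kappa> > 0\<close> \<open>m > 0\<close> assms by (intro d) auto
      finally show "\<bar>s t - sr\<bar> \<le> d" using s_less_sr[OF t] by simp
      have "\<epsilon> * sdot s t \<le> \<epsilon> * (\<kappa> * m / \<epsilon> * exp (- t / \<kappa>))"
        using mass_decay(1)[OF t m] assms by (simp add: \<kappa>_def)
      then have "sdot s t \<le> \<kappa> * m / \<epsilon> * exp (- t / \<kappa>)" using assms by (simp only: mult_le_cancel_left_pos)
      also have "\<dots> \<le> d" using N(2) \<open>\<kappa> > 0\<close> \<open>m > 0\<close> assms by (intro d) auto
      finally show "\<bar>sdot s t\<bar> \<le> d" using v_ge_0[OF t] by simp
    qed (use assms \<open>c2 > 0\<close> in auto)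
    also have "\<dots> = C * N\<^sup>2 * (exp (- b * t) * exp (- b * t))"
      by (simp add: d_def power2_eq_square mult_ac)
    \<comment> \<open>The square decays at rate \<open>2 * b\<close>; one of its two exponential
      factors is bounded by 1.\<close>
    also have "\<dots> \<le> C * N\<^sup>2 * (exp (- b * t) * 1)"
      using \<open>C > 0\<close> b(1) t by (intro mult_left_mono) auto
    also have "\<dots> = C * N\<^sup>2 / ?\<Phi>0 * ?\<Phi>0 * exp (- b * t)" using \<open>?\<Phi>0 > 0\<close> by simp
    finally show "Phi \<alpha> \<beta> \<epsilon> Tm sr c1 c2 (\<lambda>x. T x t) (s t) (sdot s t)
        \<le> C * N\<^sup>2 / ?\<Phi>0 * ?\<Phi>0 * exp (- b * t)" .
  qed
qed

end
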